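(* Let $(M,F)$ and $(N,\widetilde F)$ be Finsler manifolds of dimensions $p$ and $n$, and let $B\Gamma^{\mathbf b}_{\text{jet}}$ be the jet Berwald linear d-connection on $J^1(TM,N)$ (defined in the context). Then all local adapted d-curvatures of $B\Gamma^{\mathbf b}_{\text{jet}}$ vanish identically, except for the following thirty families: (C1) $\overline R^{\delta}_{\alpha\beta\gamma}={}^{\mathbf b}\mathcal R^{\delta}_{\alpha\beta\gamma}+{}^{\mathbf b}\mathcal P^{\delta}_{\alpha\beta c}N^c_\gamma-{}^{\mathbf b}\mathcal P^{\delta}_{\alpha\gamma c}N^c_\beta$; (C2) $\overline R^{d}_{\alpha\beta\gamma}=\mathcal A_{\{\beta,\gamma\}}\left[\frac{\partial N^d_{\alpha:\beta}}{\partial t^\gamma}+N^c_{\alpha:\beta}B^d_{c\gamma}-N^d_{\mu:\beta}B^\mu_{\alpha\gamma}\right]$; (C3) $\overline R^{\delta}_{\alpha\beta c}={}^{\mathbf b}\mathcal P^{\delta}_{\alpha\beta c}$; (C4) $\overline R^{d}_{\alpha\beta c}=\frac{\partial N^d_{\alpha:\beta}}{\partial s^c}-\frac{\partial B^d_{\alpha c}}{\partial t^\beta}+B^\mu_{\alpha\beta}B^d_{\mu c}-B^f_{\alpha c}B^d_{f\beta}$; (C5) $\overline R^{\delta}_{\alpha b\gamma}=-{}^{\mathbf b}\mathcal P^{\delta}_{\alpha b\gamma}$; (C6) $\overline R^{d}_{\alpha b\gamma}=\frac{\partial B^d_{\alpha b}}{\partial t^\gamma}-\frac{\partial N^d_{\alpha:\gamma}}{\partial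 s^b}+B^c_{\alpha b}B^d_{c\gamma}-B^\mu_{\alpha\gamma}B^d_{\mu b}$; (C7) $\overline R^{d}_{a\beta\gamma}={}^{\mathbf b}\mathcal R^{d}_{a\beta\gamma}+{}^{\mathbf b}\mathcal P^{d}_{a\beta c}N^c_\gamma-{}^{\mathbf b}\mathcal P^{d}_{a\gamma c}N^c_\beta$; (C8) $\overline R^{d}_{a\beta c}={}^{\mathbf b}\mathcal P^{d}_{a\beta c}$; (C9) $\overline R^{d}_{ab\gamma}=-{}^{\mathbf b}\mathcal P^{d}_{ab\gamma}$; (C10) $R^l_{i\beta k}=-{}^{\mathbf b}\widetilde{\mathcal P}^l_{ikj}B^c_{\beta a}s^ay^j_c$; (C11) $R^l_{ibk}=-{}^{\mathbf b}\widetilde{\mathcal P}^l_{ikj}y^j_b$; (C12) $R^l_{ijk}={}^{\mathbf b}\widetilde{\mathcal R}^l_{ijk}+{}^{\mathbf b}\widetilde{\mathcal P}^l_{ijr}\widetilde N^r_k-{}^{\mathbf b}\widetilde{\mathcal P}^l_{ikr}\widetilde N^r_j+\left[{}^{\mathbf b}\widetilde{\mathcal P}^l_{ikr}\widetilde B^r_{jp}-{}^{\mathbf b}\widetilde{\mathcal P}^l_{ijr}\widetilde B^r_{kp}\right]y^p_bs^b$; (C13) $P^{l\ (c)}_{ij(k)}={}^{\mathbf b}\widetilde{\mathcal P}^l_{ijk}s^c$; (C14) $R^{(l)(\alpha)}_{(\varepsilon)(i)\beta\gamma}=-\delta^l_i\left[{}^{\mathbf b}\mathcal R^\alpha_{\varepsilon\beta\gamma}+{}^{\mathbf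 b}\mathcal P^\alpha_{\varepsilon\beta c}N^c_\gamma-{}^{\mathbf b}\mathcal P^\alpha_{\varepsilon\gamma c}N^c_\beta\right]=-\delta^l_i\,\overline R^\alpha_{\varepsilon\beta\gamma}$; (C15) $R^{(l)(\alpha)}_{(\varepsilon)(i)\beta c}=-\delta^l_i\,{}^{\mathbf b}\mathcal P^\alpha_{\varepsilon\beta c}=-\delta^l_i\,\overline R^\alpha_{\varepsilon\beta c}$; (C16) $R^{(l)(\alpha)}_{(\varepsilon)(i)b\gamma}=\delta^l_i\,{}^{\mathbf b}\mathcal P^\alpha_{\varepsilon b\gamma}=-\delta^l_i\,\overline R^\alpha_{\varepsilon b\gamma}$; (C17) $R^{(l)(a)}_{(\varepsilon)(i)\beta\gamma}=-\delta^l_i\,\mathcal A_{\{\beta,\gamma\}}\left[\frac{\partial N^a_{\beta:\varepsilon}}{\partial t^\gamma}+N^c_{\beta:\varepsilon}B^a_{c\gamma}-N^a_{\beta:\mu}B^\mu_{\varepsilon\gamma}\right]$; (C18) $R^{(l)(a)}_{(\varepsilon)(i)\beta c}=-\delta^l_i\left[\frac{\partial N^a_{\beta:\varepsilon}}{\partial s^c}-\frac{\partial B^a_{c\varepsilon}}{\partial t^\beta}+B^\mu_{\beta\varepsilon}B^a_{\mu c}-B^d_{c\varepsilon}B^a_{d\beta}\right]$; (C19) $R^{(l)(a)}_{(\varepsilon)(i)b\gamma}=-\delta^l_i\left[\frac{\partial B^a_{b\varepsilon}}{\partial t^\gamma}-\frac{\partial N^a_{\gamma:\varepsilon}}{\partial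 s^b}+B^c_{b\varepsilon}B^a_{c\gamma}-B^\mu_{\gamma\varepsilon}B^a_{\mu b}\right]$; (C20) $R^{(l)(a)}_{(d)(i)\beta\gamma}=-\delta^l_i\left[{}^{\mathbf b}\mathcal R^a_{d\beta\gamma}+{}^{\mathbf b}\mathcal P^a_{d\beta c}N^c_\gamma-{}^{\mathbf b}\mathcal P^a_{d\gamma c}N^c_\beta\right]=-\delta^l_i\,\overline R^a_{d\beta\gamma}$; (C21) $R^{(l)(a)}_{(d)(i)\beta c}=-\delta^l_i\,{}^{\mathbf b}\mathcal P^a_{d\beta c}=-\delta^l_i\,\overline R^a_{d\beta c}$; (C22) $R^{(l)(a)}_{(d)(i)b\gamma}=\delta^l_i\,{}^{\mathbf b}\mathcal P^a_{db\gamma}=-\delta^l_i\,\overline R^a_{db\gamma}$; (C23) $R^{(l)(\alpha)}_{(\varepsilon)(i)\beta k}=-\delta^\alpha_\varepsilon\,{}^{\mathbf b}\widetilde{\mathcal P}^l_{ikj}B^c_{\beta b}s^by^j_c=\delta^\alpha_\varepsilon R^l_{i\beta k}$; (C24) $R^{(l)(\alpha)}_{(\varepsilon)(i)bk}=-\delta^\alpha_\varepsilon\,{}^{\mathbf b}\widetilde{\mathcal P}^l_{ikj}y^j_b=\delta^\alpha_\varepsilon R^l_{ibk}$; (C25) $R^{(l)(a)}_{(d)(i)\beta k}=-\delta^a_d\,{}^{\mathbf b}\widetilde{\mathcal P}^l_{ikj}B^c_{\beta b}s^by^j_c=\delta^a_dR^l_{i\beta k}$; (C26) $R^{(l)(a)}_{(d)(i)bk}=-\delta^a_d\,{}^{\mathbf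 b}\widetilde{\mathcal P}^l_{ikj}y^j_b=\delta^a_dR^l_{ibk}$; (C27) $R^{(l)(\alpha)}_{(\varepsilon)(i)jk}=\delta^\alpha_\varepsilon R^l_{ijk}$; (C28) $R^{(l)(a)}_{(d)(i)jk}=\delta^a_dR^l_{ijk}$; (C29) $P^{(l)(\alpha)\ (c)}_{(\varepsilon)(i)j(k)}=\delta^\alpha_\varepsilon\,{}^{\mathbf b}\widetilde{\mathcal P}^l_{ijk}s^c=\delta^\alpha_\varepsilon P^{l\ (c)}_{ij(k)}$; (C30) $P^{(l)(a)\ (c)}_{(d)(i)j(k)}=\delta^a_d\,{}^{\mathbf b}\widetilde{\mathcal P}^l_{ijk}s^c=\delta^a_dP^{l\ (c)}_{ij(k)}$. Here $\mathcal A_{\{\beta,\gamma\}}$ denotes the alternate sum $\mathcal A_{\{\beta,\gamma\}}[Z_{\beta\gamma}]=Z_{\beta\gamma}-Z_{\gamma\beta}$.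
   Context: Einstein summation is used. Greek indices $\alpha,\beta,\dots$ and Latin indices $a,b,c,d,f$ run over $1,\dots,p$; Latin indices $i,j,k,l,m,r$ (and $p$ when used as an index) run over $1,\dots,n$. Finsler data. A Finsler manifold $(M,F)$: $M$ smooth, $F:TM\to[0,\infty)$ smooth on $TM\setminus\{0\}$, positively 1-homogeneous on fibres, with $g_{\alpha\beta}=\frac12\frac{\partial^2F^2}{\partial s^\alpha\partial s^\beta}$ positive definite; $(t^\alpha,s^\alpha)$ are induced coordinates on $TM$. Put $\gamma^\mu_{\alpha\beta}=\frac{g^{\mu\varepsilon}}2\left(\frac{\partial g_{\varepsilon\alpha}}{\partial t^\beta}+\frac{\partial g_{\varepsilon\beta}}{\partial t^\alpha}-\frac{\partial g_{\alpha\beta}}{\partial t^\varepsilon}\right)$, $G^\mu=\frac12\gamma^\mu_{\alpha\beta}s^\alpha s^\beta$, $N^\gamma_\alpha=\frac{\partial G^\gamma}{\partial s^\alpha}$, $B^\gamma_{\alpha\beta}=\frac{\partial^2G^\gamma}{\partial s^\alpha\partial s^\beta}$ (Berwald connection components), $\frac{\delta}{\delta t^\alpha}=\frac{\partial}{\partial t^\alpha}-N^\varepsilon_\alpha\frac{\partial}{\partial s^\varepsilon}$, and ${}^{\mathbf b}\mathcal R^\alpha_{\beta\gamma\varepsilon}=\frac{\delta B^\alpha_{\beta\gamma}}{\delta t^\varepsilon}-\frac{\delta B^\alpha_{\beta\varepsilon}}{\delta t^\gamma}+B^\mu_{\beta\gamma}B^\alpha_{\mu\varepsilon}-B^\mu_{\beta\varepsilon}B^\alpha_{\mu\gamma}$,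 ${}^{\mathbf b}\mathcal P^\alpha_{\beta\gamma\varepsilon}=\frac{\partial B^\alpha_{\beta\gamma}}{\partial s^\varepsilon}$. On $TM$ the fibre coordinates are also written $s^a$; an object with mixed indices, such as $B^c_{a\beta}$, $N^c_\alpha$, ${}^{\mathbf b}\mathcal P^d_{a\beta c}$, is the same array of functions evaluated at the corresponding numerical index values. The same objects for $(N,\widetilde F)$, with coordinates $(x^i,y^i)$ on $TN$, carry tildes: $\widetilde N^i_j,\widetilde B^i_{jk},{}^{\mathbf b}\widetilde{\mathcal R}^i_{jkl},{}^{\mathbf b}\widetilde{\mathcal P}^i_{jkl}$. Jet space. Coordinates on $TM$ are $(T^A)=(t^\alpha,s^a)$, where the capital index $A=(\alpha,a)$ runs first through the $\alpha$'s and then through the $a$'s. The 1-jet space $J^1(TM,N)$ has coordinates $(T^A,x^i,X^i_A)=(t^\alpha,s^a,x^i,x^i_\alpha,y^i_a)$, where $X^i_A$ represents $\partial x^i/\partial T^A$ ($x^i_\alpha$ for $t^\alpha$, $y^i_a$ for $s^a$). All tilded functions are regarded as functions on $J^1(TM,N)$ by evaluation at $(x^l,\,y^l_as^a)$; one works where $s\ne0$ and $(y^l_as^a)_l\neq 0$. Connections. Let ${}^{\mathbf b}\nabla$ be the linear connection on $TM\setminus\{0\}$ with ${}^{\mathbf b}\nabla_{\delta/\delta t^\beta}\frac{\delta}{\delta t^\alpha}=B^\gamma_{\alpha\beta}\frac{\delta}{\delta t^\gamma}$, ${}^{\mathbf b}\nabla_{\delta/\delta t^\beta}\frac{\partial}{\partial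 s^a}=B^c_{a\beta}\frac{\partial}{\partial s^c}$, ${}^{\mathbf b}\nabla_{\partial/\partial s^b}\frac{\delta}{\delta t^\alpha}=0$, ${}^{\mathbf b}\nabla_{\partial/\partial s^b}\frac{\partial}{\partial s^a}=0$, and let ${}^{\mathbf b}\Gamma^C_{AB}$ be its components in the coordinate basis: ${}^{\mathbf b}\nabla_{\partial/\partial T^B}\frac{\partial}{\partial T^A}={}^{\mathbf b}\Gamma^C_{AB}\frac{\partial}{\partial T^C}$. Also put $N^c_{\alpha:\beta}=\frac{\partial N^c_\alpha}{\partial t^\beta}+N^d_\alpha B^c_{d\beta}-N^c_\gamma B^\gamma_{\alpha\beta}$. (Explicitly, the nonzero ones are ${}^{\mathbf b}\Gamma^\gamma_{\alpha\beta}=B^\gamma_{\alpha\beta}$, ${}^{\mathbf b}\Gamma^c_{\alpha\beta}=N^c_{\alpha:\beta}$, ${}^{\mathbf b}\Gamma^c_{a\beta}=B^c_{a\beta}$, ${}^{\mathbf b}\Gamma^c_{\alpha b}=B^c_{\alpha b}$.) The jet Berwald nonlinear connection is ${}^{\mathbf b}M^{(j)}_{(B)A}=-{}^{\mathbf b}\Gamma^C_{AB}X^j_C$, ${}^{\mathbf b}N^{(j)}_{(B)i}=\widetilde B^j_{ik}X^k_B$, with adapted basis $\frac{\delta^{\mathbf J}}{\delta T^A}=\frac{\partial}{\partial T^A}-{}^{\mathbf b}M^{(j)}_{(B)A}\frac{\partial}{\partial X^j_B}$, $\frac{\delta^{\mathbf J}}{\delta x^i}=\frac{\partial}{\partial x^i}-{}^{\mathbf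 b}N^{(j)}_{(B)i}\frac{\partial}{\partial X^j_B}$, $\frac{\partial}{\partial X^i_A}$. The jet Berwald linear d-connection $B\Gamma^{\mathbf b}_{\text{jet}}$ is the linear connection $D$ on $J^1(TM,N)$ with $D_{\delta^{\mathbf J}/\delta T^C}\frac{\delta^{\mathbf J}}{\delta T^B}=\overline G^A_{BC}\frac{\delta^{\mathbf J}}{\delta T^A}$, $D_{\delta^{\mathbf J}/\delta T^C}\frac{\delta^{\mathbf J}}{\delta x^i}=0$, $D_{\delta^{\mathbf J}/\delta T^C}\frac{\partial}{\partial X^j_B}=G^{(i)(B)}_{(A)(j)C}\frac{\partial}{\partial X^i_A}$, $D_{\delta^{\mathbf J}/\delta x^j}\frac{\delta^{\mathbf J}}{\delta T^B}=0$, $D_{\delta^{\mathbf J}/\delta x^j}\frac{\delta^{\mathbf J}}{\delta x^i}=L^k_{ij}\frac{\delta^{\mathbf J}}{\delta x^k}$, $D_{\delta^{\mathbf J}/\delta x^k}\frac{\partial}{\partial X^j_B}=L^{(i)(B)}_{(A)(j)k}\frac{\partial}{\partial X^i_A}$, and $D_{\partial/\partial X^k_C}$ annihilates all adapted basis fields, where $\overline G^A_{BC}={}^{\mathbf b}\Gamma^A_{BC}$, $G^{(i)(B)}_{(A)(j)C}=-\delta^i_j\,{}^{\mathbf b}\Gamma^B_{CA}$, $L^k_{ij}=\widetilde B^k_{ij}$, $L^{(i)(B)}_{(A)(j)k}=\delta^B_A\widetilde B^i_{jk}$ ($\delta^B_A$ the Kronecker symbol on capital indices). d-curvatures. The adapted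 d-curvatures are the components of the curvature tensor of $D$ in the adapted basis. They are named as follows: $\overline R^D_{ABC}=\frac{\delta^{\mathbf J}\overline G^D_{AB}}{\delta T^C}-\frac{\delta^{\mathbf J}\overline G^D_{AC}}{\delta T^B}+\overline G^M_{AB}\overline G^D_{MC}-\overline G^M_{AC}\overline G^D_{MB}$; $R^l_{iBk}=-\frac{\delta^{\mathbf J}L^l_{ik}}{\delta T^B}$; $R^l_{ijk}=\frac{\delta^{\mathbf J}L^l_{ij}}{\delta x^k}-\frac{\delta^{\mathbf J}L^l_{ik}}{\delta x^j}+L^m_{ij}L^l_{mk}-L^m_{ik}L^l_{mj}$; $P^{l\ (G)}_{ij(k)}=\frac{\partial L^l_{ij}}{\partial X^k_G}$; $R^{(l)(A)}_{(D)(i)BC}=\frac{\delta^{\mathbf J}G^{(l)(A)}_{(D)(i)B}}{\delta T^C}-\frac{\delta^{\mathbf J}G^{(l)(A)}_{(D)(i)C}}{\delta T^B}+G^{(m)(A)}_{(M)(i)B}G^{(l)(M)}_{(D)(m)C}-G^{(m)(A)}_{(M)(i)C}G^{(l)(M)}_{(D)(m)B}$; $R^{(l)(A)}_{(D)(i)Bk}=\frac{\delta^{\mathbf J}G^{(l)(A)}_{(D)(i)B}}{\delta x^k}-\frac{\delta^{\mathbf J}L^{(l)(A)}_{(D)(i)k}}{\delta T^B}+G^{(m)(A)}_{(M)(i)B}L^{(l)(M)}_{(D)(m)k}-L^{(m)(A)}_{(M)(i)k}G^{(l)(M)}_{(D)(m)B}$; $R^{(l)(A)}_{(D)(i)jk}=\frac{\delta^{\mathbf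 J}L^{(l)(A)}_{(D)(i)j}}{\delta x^k}-\frac{\delta^{\mathbf J}L^{(l)(A)}_{(D)(i)k}}{\delta x^j}+L^{(m)(A)}_{(M)(i)j}L^{(l)(M)}_{(D)(m)k}-L^{(m)(A)}_{(M)(i)k}L^{(l)(M)}_{(D)(m)j}$; $P^{(l)(A)\ (G)}_{(D)(i)j(k)}=\frac{\partial L^{(l)(A)}_{(D)(i)j}}{\partial X^k_G}$. (E.g. $\overline R^D_{ABC}$ is the $\frac{\delta^{\mathbf J}}{\delta T^D}$-component of $R\big(\frac{\delta^{\mathbf J}}{\delta T^C},\frac{\delta^{\mathbf J}}{\delta T^B}\big)\frac{\delta^{\mathbf J}}{\delta T^A}$, where $R(X,Y)=[D_X,D_Y]-D_{[X,Y]}$.) In the claim each capital index is split into its Greek and Latin parts. *)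

theory Defs
  imports "HOL-Analysis.Analysis"
begin

section \<open>Smooth functions and smooth manifolds\<close>

text \<open>\<open>Ck_on k f S\<close> is meant for open \<open>S\<close>.\<close>

primrec Ck_on ::
  "nat \<Rightarrow> ('a::real_normed_vector \<Rightarrow> 'b::real_normed_vector) \<Rightarrow> 'a set \<Rightarrow> bool" where
  "Ck_on 0 f S \<longleftrightarrow> continuous_on S f"
| "Ck_on (Suc k) f S \<longleftrightarrow>
     (\<forall>x\<in>S. f differentiable (at x)) \<and>
     (\<forall>v. Ck_on k (\<lambda>x. frechet_derivative f (at x) v) S)"

definition smooth_on ::
  "('a::real_normed_vector \<Rightarrow> 'b::real_normed_vector) \<Rightarrow> 'a set \<Rightarrow> bool" where
  "smooth_on f S \<longleftrightarrow> (\<forall>k. Ck_on k f S)"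

text \<open>A chart is a pair of a domain and a coordinate map; the values of the coordinate map outside
  the domain are irrelevant.\<close>

type_synonym ('a, 'p) chart = "'a set \<times> ('a \<Rightarrow> real^'p)"

definition is_chart :: "'a topology \<Rightarrow> ('a, 'p::finite) chart \<Rightarrow> bool" where
  "is_chart M c \<longleftrightarrow> openin M (fst c) \<and> open (snd c ` fst c) \<and>
     homeomorphic_map (subtopology M (fst c)) (top_of_set (snd c ` fst c)) (snd c)"

definition chart_inv :: "('a, 'p::finite) chart \<Rightarrow> real^'p \<Rightarrow> 'a" where
  "chart_inv c = the_inv_into (fst c) (snd c)"

definition transition :: "('a, 'p::finite) chart \<Rightarrow> ('a, 'p) chart \<Rightarrow> real^'p \<Rightarrow> real^'p" where
  "transition c d = snd d \<circ> chart_inv c"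

definition smooth_manifold :: "'a topology \<Rightarrow> ('a, 'p::finite) chart set \<Rightarrow> bool" where
  "smooth_manifold M \<A> \<longleftrightarrow>
     Hausdorff_space M \<and> second_countable M \<and>
     (\<forall>c\<in>\<A>. is_chart M c) \<and> \<Union>(fst ` \<A>) = topspace M \<and>
     (\<forall>c\<in>\<A>. \<forall>d\<in>\<A>. smooth_on (transition c d) (snd c ` (fst c \<inter> fst d)))"

text \<open>A tangent vector at \<open>m\<close> is the family of its component vectors in all charts around \<open>m\<close>,
  related by the Jacobians of the transition maps (and set to zero for all other charts).\<close>

definition tangent_space ::
  "('a, 'p::finite) chart set \<Rightarrow> 'a \<Rightarrow> (('a, 'p) chart \<Rightarrow> real^'p) set" where
  "tangent_space \<A> m =
     {v. (\<forall>c. \<not> (c \<in> \<A> \<and> m \<in> fst c) \<longrightarrow> v c = 0) \<and>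
         (\<forall>c\<in>\<A>. \<forall>d\<in>\<A>. m \<in> fst c \<and> m \<in> fst d \<longrightarrow>
            v d = frechet_derivative (transition c d) (at (snd c m)) (v c))}"

text \<open>The tangent vector at \<open>m\<close> with components \<open>s\<close> in the chart \<open>c\<close>.\<close>

definition tangent_vector ::
  "('a, 'p::finite) chart set \<Rightarrow> ('a, 'p) chart \<Rightarrow> 'a \<Rightarrow> real^'p \<Rightarrow> (('a, 'p) chart \<Rightarrow> real^'p)" where
  "tangent_vector \<A> c m s =
     (\<lambda>d. if d \<in> \<A> \<and> m \<in> fst d
          then frechet_derivative (transition c d) (at (snd c m)) s else 0)"

section \<open>Finsler manifolds\<close>

text \<open>Induced coordinates on the tangent bundle form a vector \<open>u\<close> of type \<open>real^('p + 'p)\<close>: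
  \<open>u $ Inl \<alpha>\<close> is the base coordinate \<open>t\<^sup>\<alpha>\<close> and \<open>u $ Inr a\<close> the fibre coordinate \<open>s\<^sup>a\<close>.\<close>

definition base_part :: "real^('p::finite + 'p) \<Rightarrow> real^'p" where
  "base_part u = (\<chi> \<alpha>. u $ Inl \<alpha>)"

definition fibre_part :: "real^('p::finite + 'p) \<Rightarrow> real^'p" where
  "fibre_part u = (\<chi> a. u $ Inr a)"

text \<open>Coordinate domain of the slit tangent bundle over a chart.\<close>

definition slit_dom :: "('a, 'p::finite) chart \<Rightarrow> (real^('p + 'p)) set" where
  "slit_dom c = {u. base_part u \<in> snd c ` fst c \<and> fibre_part u \<noteq> 0}"

type_synonym ('a, 'p) tm_fun = "'a \<times> (('a, 'p) chart \<Rightarrow> real^'p) \<Rightarrow> real"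

definition chart_rep ::
  "('a, 'p::finite) chart set \<Rightarrow> ('a, 'p) tm_fun \<Rightarrow> ('a, 'p) chart \<Rightarrow> real^('p + 'p) \<Rightarrow> real" where
  "chart_rep \<A> F c u =
     (let m = chart_inv c (base_part u) in F (m, tangent_vector \<A> c m (fibre_part u)))"

definition pd :: "'k::finite \<Rightarrow> (real^'k \<Rightarrow> real) \<Rightarrow> real^'k \<Rightarrow> real" where
  "pd I f u = frechet_derivative f (at u) (axis I 1)"

text \<open>In this theory the upper index of an array is always its first index argument; the lower
  indices follow in their order. \<open>L\<close> is the coordinate expression of a Finsler function.\<close>

definition fund_tensor :: "(real^('p::finite + 'p) \<Rightarrow> real) \<Rightarrow> 'p \<Rightarrow> 'p \<Rightarrow> real^('p + 'p) \<Rightarrow> real" where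
  "fund_tensor L \<alpha> \<beta> u = 1/2 * pd (Inr \<alpha>) (pd (Inr \<beta>) (\<lambda>w. (L w)\<^sup>2)) u"

definition finsler_manifold ::
  "'a topology \<Rightarrow> ('a, 'p::finite) chart set \<Rightarrow> ('a, 'p) tm_fun \<Rightarrow> bool" where
  "finsler_manifold M \<A> F \<longleftrightarrow>
     smooth_manifold M \<A> \<and>
     (\<forall>m\<in>topspace M. \<forall>v\<in>tangent_space \<A> m. F (m, v) \<ge> 0) \<and>
     (\<forall>m\<in>topspace M. \<forall>v\<in>tangent_space \<A> m. \<forall>r>0. F (m, \<lambda>c. r *\<^sub>R v c) = r * F (m, v)) \<and>
     (\<forall>c\<in>\<A>. smooth_on (chart_rep \<A> F c) (slit_dom c) \<and>
        (\<forall>u\<in>slit_dom c. \<forall>w::real^'p. w \<noteq> 0 \<longrightarrow>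
           (\<Sum>\<alpha>\<in>UNIV. \<Sum>\<beta>\<in>UNIV. fund_tensor (chart_rep \<A> F c) \<alpha> \<beta> u * w$\<alpha> * w$\<beta>) > 0))"

definition fund_inv :: "(real^('p::finite + 'p) \<Rightarrow> real) \<Rightarrow> 'p \<Rightarrow> 'p \<Rightarrow> real^('p + 'p) \<Rightarrow> real" where
  "fund_inv L \<mu> \<epsilon> u = matrix_inv (\<chi> \<alpha> \<beta>. fund_tensor L \<alpha> \<beta> u) $ \<mu> $ \<epsilon>"

definition christoffel ::
  "(real^('p::finite + 'p) \<Rightarrow> real) \<Rightarrow> 'p \<Rightarrow> 'p \<Rightarrow> 'p \<Rightarrow> real^('p + 'p) \<Rightarrow> real" where
  "christoffel L \<mu> \<alpha> \<beta> u =
     (\<Sum>\<epsilon>\<in>UNIV. fund_inv L \<mu> \<epsilon> u / 2 *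
        (pd (Inl \<beta>) (fund_tensor L \<epsilon> \<alpha>) u + pd (Inl \<alpha>) (fund_tensor L \<epsilon> \<beta>) u
         - pd (Inl \<epsilon>) (fund_tensor L \<alpha> \<beta>) u))"

definition spray :: "(real^('p::finite + 'p) \<Rightarrow> real) \<Rightarrow> 'p \<Rightarrow> real^('p + 'p) \<Rightarrow> real" where
  "spray L \<mu> u =
     1/2 * (\<Sum>\<alpha>\<in>UNIV. \<Sum>\<beta>\<in>UNIV. christoffel L \<mu> \<alpha> \<beta> u * u $ Inr \<alpha> * u $ Inr \<beta>)"

text \<open>\<open>N\<^sup>\<gamma>\<^sub>\<alpha>\<close>\<close>

definition nonlin :: "(real^('p::finite + 'p) \<Rightarrow> real) \<Rightarrow> 'p \<Rightarrow> 'p \<Rightarrow> real^('p + 'p) \<Rightarrow> real" where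
  "nonlin L \<gamma> \<alpha> = pd (Inr \<alpha>) (spray L \<gamma>)"

definition berwald ::
  "(real^('p::finite + 'p) \<Rightarrow> real) \<Rightarrow> 'p \<Rightarrow> 'p \<Rightarrow> 'p \<Rightarrow> real^('p + 'p) \<Rightarrow> real" where
  "berwald L \<gamma> \<alpha> \<beta> = pd (Inr \<alpha>) (pd (Inr \<beta>) (spray L \<gamma>))"

text \<open>The operator \<open>\<delta>/\<delta>t\<^sup>\<alpha>\<close> on functions\<close>

definition delta_t :: "(real^('p::finite + 'p) \<Rightarrow> real) \<Rightarrow> 'p \<Rightarrow> (real^('p + 'p) \<Rightarrow> real) \<Rightarrow> real^('p + 'p) \<Rightarrow> real" where
  "delta_t L \<alpha> f u = pd (Inl \<alpha>) f u - (\<Sum>\<epsilon>\<in>UNIV. nonlin L \<epsilon> \<alpha> u * pd (Inr \<epsilon>) f u)"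

definition berwald_R ::
  "(real^('p::finite + 'p) \<Rightarrow> real) \<Rightarrow> 'p \<Rightarrow> 'p \<Rightarrow> 'p \<Rightarrow> 'p \<Rightarrow> real^('p + 'p) \<Rightarrow> real" where
  "berwald_R L \<alpha> \<beta> \<gamma> \<epsilon> u =
     delta_t L \<epsilon> (berwald L \<alpha> \<beta> \<gamma>) u - delta_t L \<gamma> (berwald L \<alpha> \<beta> \<epsilon>) u
     + (\<Sum>\<mu>\<in>UNIV. berwald L \<mu> \<beta> \<gamma> u * berwald L \<alpha> \<mu> \<epsilon> u)
     - (\<Sum>\<mu>\<in>UNIV. berwald L \<mu> \<beta> \<epsilon> u * berwald L \<alpha> \<mu> \<gamma> u)"

definition berwald_P ::
  "(real^('p::finite + 'p) \<Rightarrow> real) \<Rightarrow> 'p \<Rightarrow> 'p \<Rightarrow> 'p \<Rightarrow> 'p \<Rightarrow> real^('p + 'p) \<Rightarrow> real" where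
  "berwald_P L \<alpha> \<beta> \<gamma> \<epsilon> = pd (Inr \<epsilon>) (berwald L \<alpha> \<beta> \<gamma>)"

text \<open>\<open>nonlin_cov L c \<alpha> \<beta>\<close> is \<open>N\<^sup>c\<close> with lower indices \<open>\<alpha> : \<beta>\<close>.\<close>

definition nonlin_cov ::
  "(real^('p::finite + 'p) \<Rightarrow> real) \<Rightarrow> 'p \<Rightarrow> 'p \<Rightarrow> 'p \<Rightarrow> real^('p + 'p) \<Rightarrow> real" where
  "nonlin_cov L c \<alpha> \<beta> u =
     pd (Inl \<beta>) (nonlin L c \<alpha>) u
     + (\<Sum>d\<in>UNIV. nonlin L d \<alpha> u * berwald L c d \<beta> u)
     - (\<Sum>\<gamma>\<in>UNIV. nonlin L c \<gamma> u * berwald L \<gamma> \<alpha> \<beta> u)"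

section \<open>Linear connections given by their coefficients in a frame\<close>

type_synonym 'k vfield = "real^'k \<Rightarrow> real^'k"

definition frame_comp :: "('k::finite \<Rightarrow> 'k vfield) \<Rightarrow> real^'k \<Rightarrow> real^'k \<Rightarrow> 'k \<Rightarrow> real" where
  "frame_comp e u v = (THE c. v = (\<Sum>I\<in>UNIV. c I *\<^sub>R e I u))"

text \<open>\<open>frame_conn e \<omega>\<close> is the linear connection \<open>D\<close> whose value \<open>D\<close> of \<open>e I\<close> in the
  direction \<open>e J\<close> is the sum over \<open>K\<close> of \<open>\<omega> K I J\<close> times \<open>e K\<close>; its value on arbitrary fields
  \<open>X\<close> (direction) and \<open>Y\<close> (argument) is forced by tensoriality in \<open>X\<close> and the Leibniz rule in \<open>Y\<close>.\<close>

definition frame_conn ::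
  "('k::finite \<Rightarrow> 'k vfield) \<Rightarrow> ('k \<Rightarrow> 'k \<Rightarrow> 'k \<Rightarrow> real^'k \<Rightarrow> real) \<Rightarrow> 'k vfield \<Rightarrow> 'k vfield \<Rightarrow> 'k vfield" where
  "frame_conn e \<omega> X Y u =
     (\<Sum>K\<in>UNIV.
        (frechet_derivative (\<lambda>w. frame_comp e w (Y w) K) (at u) (X u)
         + (\<Sum>I\<in>UNIV. \<Sum>J\<in>UNIV.
              \<omega> K I J u * frame_comp e u (Y u) I * frame_comp e u (X u) J)) *\<^sub>R e K u)"

definition lie_bracket :: "'k::finite vfield \<Rightarrow> 'k vfield \<Rightarrow> 'k vfield" where
  "lie_bracket X Y u = frechet_derivative Y (at u) (X u) - frechet_derivative X (at u) (Y u)"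

definition curvature ::
  "('k::finite vfield \<Rightarrow> 'k vfield \<Rightarrow> 'k vfield) \<Rightarrow> 'k vfield \<Rightarrow> 'k vfield \<Rightarrow> 'k vfield \<Rightarrow> 'k vfield" where
  "curvature D X Y Z u = D X (D Y Z) u - D Y (D X Z) u - D (lie_bracket X Y) Z u"

lemma frame_comp_eq:
  assumes "\<And>c. (\<Sum>I\<in>UNIV. c I *\<^sub>R e I u) = 0 \<Longrightarrow> c = (\<lambda>_. 0)"
    and "v = (\<Sum>I\<in>UNIV. a I *\<^sub>R e I u)"
  shows "frame_comp e u v = a"
  unfolding frame_comp_def
proof (rule the_equality)
  show "v = (\<Sum>I\<in>UNIV. a I *\<^sub>R e I u)" by fact
next
  fix c assume "v = (\<Sum>I\<in>UNIV. c I *\<^sub>R e I u)"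
  then have "(\<Sum>I\<in>UNIV. (c I - a I) *\<^sub>R e I u) = 0"
    using assms(2) by (simp add: scaleR_diff_left sum_subtractf)
  from assms(1)[OF this] show "c = a" by (simp add: fun_eq_iff)
qed

lemma frame_conn_frame:
  assumes "open S" "u \<in> S"
    and indep: "\<And>w c. w \<in> S \<Longrightarrow> (\<Sum>I\<in>UNIV. c I *\<^sub>R e I w) = 0 \<Longrightarrow> c = (\<lambda>_. 0)"
  shows "frame_conn e \<omega> (e J) (e I) u = (\<Sum>K\<in>UNIV. \<omega> K I J u *\<^sub>R e K u)"
proof -
  have comp: "frame_comp e w (e H w) = (\<lambda>K. if K = H then 1 else 0)" if "w \<in> S" for w H
    by (rule frame_comp_eq[OF indep[OF that]])
       (simp_all add: if_distrib[of "\<lambda>r. r *\<^sub>R _"] cong: if_cong)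
  have "((\<lambda>w. frame_comp e w (e I w) K) has_derivative (\<lambda>_. 0)) (at u)" for K
  proof (rule has_derivative_transform_within_open[OF _ \<open>open S\<close> \<open>u \<in> S\<close>])
    show "((\<lambda>w. if K = I then 1 else 0) has_derivative (\<lambda>_. 0)) (at u)" by (rule has_derivative_const)
  qed (simp add: comp)
  then have "frechet_derivative (\<lambda>w. frame_comp e w (e I w) K) (at u) = (\<lambda>_. 0)" for K
    by (metis frechet_derivative_at)
  then show ?thesis
    by (simp add: frame_conn_def comp[OF \<open>u \<in> S\<close>] if_distrib[of "\<lambda>r. _ * r"] cong: if_cong)
qed

section \<open>The Berwald connection on the slit tangent bundle\<close>

text \<open>Adapted frame: \<open>Inl \<alpha>\<close> stands for \<open>\<delta>/\<delta>t\<^sup>\<alpha>\<close> and \<open>Inr a\<close> for \<open>\<partial>/\<partial>s\<^sup>a\<close>.\<close>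

fun tm_frame :: "(real^('p::finite + 'p) \<Rightarrow> real) \<Rightarrow> 'p + 'p \<Rightarrow> ('p + 'p) vfield" where
  "tm_frame L (Inl \<alpha>) u = axis (Inl \<alpha>) 1 - (\<Sum>\<epsilon>\<in>UNIV. nonlin L \<epsilon> \<alpha> u *\<^sub>R axis (Inr \<epsilon>) 1)"
| "tm_frame L (Inr a) u = axis (Inr a) 1"

fun tm_coeff ::
  "(real^('p::finite + 'p) \<Rightarrow> real) \<Rightarrow> 'p + 'p \<Rightarrow> 'p + 'p \<Rightarrow> 'p + 'p \<Rightarrow> real^('p + 'p) \<Rightarrow> real" where
  "tm_coeff L (Inl \<gamma>) (Inl \<alpha>) (Inl \<beta>) u = berwald L \<gamma> \<alpha> \<beta> u"
| "tm_coeff L (Inr c) (Inr a) (Inl \<beta>) u = berwald L c a \<beta> u"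
| "tm_coeff L _ _ _ u = 0"

definition tm_conn ::
  "(real^('p::finite + 'p) \<Rightarrow> real) \<Rightarrow> ('p + 'p) vfield \<Rightarrow> ('p + 'p) vfield \<Rightarrow> ('p + 'p) vfield" where
  "tm_conn L = frame_conn (tm_frame L) (tm_coeff L)"

text \<open>\<open>tm_Gamma L C A B\<close> is the component along \<open>\<partial>/\<partial>T\<^sup>C\<close> of the derivative of \<open>\<partial>/\<partial>T\<^sup>A\<close> in the
  direction \<open>\<partial>/\<partial>T\<^sup>B\<close>.\<close>

definition tm_Gamma ::
  "(real^('p::finite + 'p) \<Rightarrow> real) \<Rightarrow> 'p + 'p \<Rightarrow> 'p + 'p \<Rightarrow> 'p + 'p \<Rightarrow> real^('p + 'p) \<Rightarrow> real" where
  "tm_Gamma L C A B u = tm_conn L (\<lambda>_. axis B 1) (\<lambda>_. axis A 1) u $ C"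

section \<open>The jet Berwald linear d-connection\<close>

text \<open>A capital index is an element of \<open>'p + 'p\<close>, with \<open>Inl\<close> marking Greek and \<open>Inr\<close> Latin indices.
  The coordinates on the 1-jet space (and the members of adapted frames) are indexed by
  \<open>('p + 'p) + 'n + 'n \<times> ('p + 'p)\<close>, standing for \<open>T\<^sup>A\<close>, \<open>x\<^sup>i\<close> and \<open>X\<^sup>i\<^sub>A\<close>.\<close>

type_synonym ('p, 'n) jidx = "('p + 'p) + 'n + 'n \<times> ('p + 'p)"
type_synonym ('p, 'n) jet = "real^(('p + 'p) + 'n + 'n \<times> ('p + 'p))"

abbreviation hT :: "'p + 'p \<Rightarrow> ('p, 'n) jidx" where "hT A \<equiv> Inl A"
abbreviation hx :: "'n \<Rightarrow> ('p, 'n) jidx" where "hx i \<equiv> Inr (Inl i)"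
abbreviation vX :: "'n \<Rightarrow> 'p + 'p \<Rightarrow> ('p, 'n) jidx" where "vX i A \<equiv> Inr (Inr (i, A))"

definition TM_part :: "('p::finite, 'n::finite) jet \<Rightarrow> real^('p + 'p)" where
  "TM_part z = (\<chi> A. z $ hT A)"

text \<open>The point of \<open>TN\<close> with coordinates \<open>(x\<^sup>l, y\<^sup>l\<^sub>a s\<^sup>a)\<close>\<close>

definition TN_part :: "('p::finite, 'n::finite) jet \<Rightarrow> real^('n + 'n)" where
  "TN_part z =
     (\<chi> I. case I of Inl l \<Rightarrow> z $ hx l | Inr l \<Rightarrow> (\<Sum>a\<in>UNIV. z $ vX l (Inr a) * z $ hT (Inr a)))"

definition jet_dom :: "('a, 'p::finite) chart \<Rightarrow> ('b, 'n::finite) chart \<Rightarrow> ('p, 'n) jet set" where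
  "jet_dom c d = {z. TM_part z \<in> slit_dom c \<and> TN_part z \<in> slit_dom d}"

definition kron :: "'i \<Rightarrow> 'i \<Rightarrow> real" where
  "kron i j = (if i = j then 1 else 0)"

text \<open>\<open>jet_M L j B A\<close> and \<open>jet_N Lt j B i\<close> are the coefficients with index pair \<open>(j), (B)\<close> and last
  lower index \<open>A\<close>, respectively \<open>i\<close>.\<close>

definition jet_M ::
  "(real^('p::finite + 'p) \<Rightarrow> real) \<Rightarrow> 'n \<Rightarrow> 'p + 'p \<Rightarrow> 'p + 'p \<Rightarrow> ('p, 'n::finite) jet \<Rightarrow> real" where
  "jet_M L j B A z = - (\<Sum>C\<in>UNIV. tm_Gamma L C A B (TM_part z) * z $ vX j C)"

definition jet_N ::
  "(real^('n::finite + 'n) \<Rightarrow> real) \<Rightarrow> 'n \<Rightarrow> 'p + 'p \<Rightarrow> 'n \<Rightarrow> ('p::finite, 'n) jet \<Rightarrow> real" where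
  "jet_N Lt j B i z = (\<Sum>k\<in>UNIV. berwald Lt j i k (TN_part z) * z $ vX k B)"

fun jet_frame ::
  "(real^('p::finite + 'p) \<Rightarrow> real) \<Rightarrow> (real^('n::finite + 'n) \<Rightarrow> real) \<Rightarrow>
   ('p, 'n) jidx \<Rightarrow> ('p, 'n) jidx vfield" where
  "jet_frame L Lt (Inl A) z =
     axis (hT A) 1 - (\<Sum>j\<in>UNIV. \<Sum>B\<in>UNIV. jet_M L j B A z *\<^sub>R axis (vX j B) 1)"
| "jet_frame L Lt (Inr (Inl i)) z =
     axis (hx i) 1 - (\<Sum>j\<in>UNIV. \<Sum>B\<in>UNIV. jet_N Lt j B i z *\<^sub>R axis (vX j B) 1)"
| "jet_frame L Lt (Inr (Inr (i, A))) z = axis (vX i A) 1"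

definition jet_Gbar ::
  "(real^('p::finite + 'p) \<Rightarrow> real) \<Rightarrow> 'p + 'p \<Rightarrow> 'p + 'p \<Rightarrow> 'p + 'p \<Rightarrow> ('p, 'n::finite) jet \<Rightarrow> real" where
  "jet_Gbar L A B C z = tm_Gamma L A B C (TM_part z)"

text \<open>In \<open>jet_G\<close> and \<open>jet_LX\<close> the index pairs come in the order \<open>(i)(A)\<close>, \<open>(j)(B)\<close>: the value is the
  component along \<open>\<partial>/\<partial>X\<^sup>i\<^sub>A\<close> of the derivative of \<open>\<partial>/\<partial>X\<^sup>j\<^sub>B\<close>.\<close>

definition jet_G ::
  "(real^('p::finite + 'p) \<Rightarrow> real) \<Rightarrow> 'n \<Rightarrow> 'p + 'p \<Rightarrow> 'n \<Rightarrow> 'p + 'p \<Rightarrow> 'p + 'p \<Rightarrow> ('p, 'n::finite) jet \<Rightarrow> real" where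
  "jet_G L i A j B C z = - kron i j * tm_Gamma L B C A (TM_part z)"

definition jet_L ::
  "(real^('n::finite + 'n) \<Rightarrow> real) \<Rightarrow> 'n \<Rightarrow> 'n \<Rightarrow> 'n \<Rightarrow> ('p::finite, 'n) jet \<Rightarrow> real" where
  "jet_L Lt k i j z = berwald Lt k i j (TN_part z)"

definition jet_LX ::
  "(real^('n::finite + 'n) \<Rightarrow> real) \<Rightarrow> 'n \<Rightarrow> 'p + 'p \<Rightarrow> 'n \<Rightarrow> 'p + 'p \<Rightarrow> 'n \<Rightarrow> ('p::finite, 'n) jet \<Rightarrow> real" where
  "jet_LX Lt i A j B k z = kron B A * berwald Lt i j k (TN_part z)"

text \<open>The index arguments of \<open>jet_coeff\<close> are: component, differentiated frame field, direction.\<close>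

fun jet_coeff ::
  "(real^('p::finite + 'p) \<Rightarrow> real) \<Rightarrow> (real^('n::finite + 'n) \<Rightarrow> real) \<Rightarrow>
   ('p, 'n) jidx \<Rightarrow> ('p, 'n) jidx \<Rightarrow> ('p, 'n) jidx \<Rightarrow> ('p, 'n) jet \<Rightarrow> real" where
  "jet_coeff L Lt (Inl A) (Inl B) (Inl C) z = jet_Gbar L A B C z"
| "jet_coeff L Lt (Inr (Inr (i, A))) (Inr (Inr (j, B))) (Inl C) z = jet_G L i A j B C z"
| "jet_coeff L Lt (Inr (Inl k)) (Inr (Inl i)) (Inr (Inl j)) z = jet_L Lt k i j z"
| "jet_coeff L Lt (Inr (Inr (i, A))) (Inr (Inr (j, B))) (Inr (Inl k)) z = jet_LX Lt i A j B k z"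
| "jet_coeff L Lt _ _ _ z = 0"

definition jet_berwald ::
  "(real^('p::finite + 'p) \<Rightarrow> real) \<Rightarrow> (real^('n::finite + 'n) \<Rightarrow> real) \<Rightarrow>
   ('p, 'n) jidx vfield \<Rightarrow> ('p, 'n) jidx vfield \<Rightarrow> ('p, 'n) jidx vfield" where
  "jet_berwald L Lt = frame_conn (jet_frame L Lt) (jet_coeff L Lt)"

section \<open>Adapted d-curvatures\<close>

text \<open>\<open>d_curv L Lt H I J K\<close> is the component along the adapted frame field number \<open>H\<close> of the curvature
  applied to field \<open>I\<close>, with \<open>K\<close> as first and \<open>J\<close> as second direction.\<close>

definition d_curv ::
  "(real^('p::finite + 'p) \<Rightarrow> real) \<Rightarrow> (real^('n::finite + 'n) \<Rightarrow> real) \<Rightarrow>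
   ('p, 'n) jidx \<Rightarrow> ('p, 'n) jidx \<Rightarrow> ('p, 'n) jidx \<Rightarrow> ('p, 'n) jidx \<Rightarrow> ('p, 'n) jet \<Rightarrow> real" where
  "d_curv L Lt H I J K z =
     frame_comp (jet_frame L Lt) z
       (curvature (jet_berwald L Lt) (jet_frame L Lt K) (jet_frame L Lt J) (jet_frame L Lt I) z) H"

text \<open>The eight named kinds. In the last four, the leading arguments \<open>l D i A\<close> stand for the index
  pairs \<open>(l)(D)\<close> and \<open>(i)(A)\<close> with \<open>l\<close>, \<open>A\<close> upper and \<open>D\<close>, \<open>i\<close> lower; in the two \<open>P\<close> kinds, the
  trailing \<open>k G\<close> is the pair of lower \<open>(k)\<close> and upper \<open>(G)\<close>. Because the bracket of any two
  adapted fields is vertical and vertical derivatives annihilate the frame, the component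
  \<open>d_curv\<close> has no bracket contribution and equals the customary expression in the coefficients,
  for instance \<open>curv_hxT l i B k\<close> is minus the \<open>\<delta>/\<delta>T\<^sup>B\<close>-derivative of \<open>jet_L Lt l i k\<close>.\<close>

definition curv_TTT where
  "curv_TTT L Lt D A B C z = d_curv L Lt (hT D) (hT A) (hT B) (hT C) z"
definition curv_xTx where
  "curv_xTx L Lt l i B k z = d_curv L Lt (hx l) (hx i) (hT B) (hx k) z"
definition curv_xxx where
  "curv_xxx L Lt l i j k z = d_curv L Lt (hx l) (hx i) (hx j) (hx k) z"
definition curvP_x where
  "curvP_x L Lt l i j k G z = d_curv L Lt (hx l) (hx i) (hx j) (vX k G) z"
definition curv_XTT where
  "curv_XTT L Lt l D i A B C z = d_curv L Lt (vX l D) (vX i A) (hT B) (hT C) z"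
definition curv_XTx where
  "curv_XTx L Lt l D i A B k z = d_curv L Lt (vX l D) (vX i A) (hT B) (hx k) z"
definition curv_Xxx where
  "curv_Xxx L Lt l D i A j k z = d_curv L Lt (vX l D) (vX i A) (hx j) (hx k) z"
definition curvP_X where
  "curvP_X L Lt l D i A j k G z = d_curv L Lt (vX l D) (vX i A) (hx j) (vX k G) z"

text \<open>Index patterns (arguments in the order of \<open>d_curv\<close>) of the components that are allowed to be
  nonzero.\<close>

inductive listed ::
  "('p, 'n) jidx \<Rightarrow> ('p, 'n) jidx \<Rightarrow> ('p, 'n) jidx \<Rightarrow> ('p, 'n) jidx \<Rightarrow> bool" where
  "listed (hT (Inl \<delta>)) (hT (Inl \<alpha>)) (hT (Inl \<beta>)) (hT (Inl \<gamma>))"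
| "listed (hT (Inr d)) (hT (Inl \<alpha>)) (hT (Inl \<beta>)) (hT (Inl \<gamma>))"
| "listed (hT (Inl \<delta>)) (hT (Inl \<alpha>)) (hT (Inl \<beta>)) (hT (Inr c))"
| "listed (hT (Inr d)) (hT (Inl \<alpha>)) (hT (Inl \<beta>)) (hT (Inr c))"
| "listed (hT (Inl \<delta>)) (hT (Inl \<alpha>)) (hT (Inr b)) (hT (Inl \<gamma>))"
| "listed (hT (Inr d)) (hT (Inl \<alpha>)) (hT (Inr b)) (hT (Inl \<gamma>))"
| "listed (hT (Inr d)) (hT (Inr a)) (hT (Inl \<beta>)) (hT (Inl \<gamma>))"
| "listed (hT (Inr d)) (hT (Inr a)) (hT (Inl \<beta>)) (hT (Inr c))"
| "listed (hT (Inr d)) (hT (Inr a)) (hT (Inr b)) (hT (Inl \<gamma>))"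
| "listed (hx l) (hx i) (hT (Inl \<beta>)) (hx k)"
| "listed (hx l) (hx i) (hT (Inr b)) (hx k)"
| "listed (hx l) (hx i) (hx j) (hx k)"
| "listed (hx l) (hx i) (hx j) (vX k (Inr c))"
| "listed (vX l (Inl \<epsilon>)) (vX i (Inl \<alpha>)) (hT (Inl \<beta>)) (hT (Inl \<gamma>))"
| "listed (vX l (Inl \<epsilon>)) (vX i (Inl \<alpha>)) (hT (Inl \<beta>)) (hT (Inr c))"
| "listed (vX l (Inl \<epsilon>)) (vX i (Inl \<alpha>)) (hT (Inr b)) (hT (Inl \<gamma>))"
| "listed (vX l (Inl \<epsilon>)) (vX i (Inr a)) (hT (Inl \<beta>)) (hT (Inl \<gamma>))"
| "listed (vX l (Inl \<epsilon>)) (vX i (Inr a)) (hT (Inl \<beta>)) (hT (Inr c))"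
| "listed (vX l (Inl \<epsilon>)) (vX i (Inr a)) (hT (Inr b)) (hT (Inl \<gamma>))"
| "listed (vX l (Inr d)) (vX i (Inr a)) (hT (Inl \<beta>)) (hT (Inl \<gamma>))"
| "listed (vX l (Inr d)) (vX i (Inr a)) (hT (Inl \<beta>)) (hT (Inr c))"
| "listed (vX l (Inr d)) (vX i (Inr a)) (hT (Inr b)) (hT (Inl \<gamma>))"
| "listed (vX l (Inl \<epsilon>)) (vX i (Inl \<alpha>)) (hT (Inl \<beta>)) (hx k)"
| "listed (vX l (Inl \<epsilon>)) (vX i (Inl \<alpha>)) (hT (Inr b)) (hx k)"
| "listed (vX l (Inr d)) (vX i (Inr a)) (hT (Inl \<beta>)) (hx k)"
| "listed (vX l (Inr d)) (vX i (Inr a)) (hT (Inr b)) (hx k)"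
| "listed (vX l (Inl \<epsilon>)) (vX i (Inl \<alpha>)) (hx j) (hx k)"
| "listed (vX l (Inr d)) (vX i (Inr a)) (hx j) (hx k)"
| "listed (vX l (Inl \<epsilon>)) (vX i (Inl \<alpha>)) (hx j) (vX k (Inr c))"
| "listed (vX l (Inr d)) (vX i (Inr a)) (hx j) (vX k (Inr c))"

definition alt :: "('i \<Rightarrow> 'i \<Rightarrow> real) \<Rightarrow> 'i \<Rightarrow> 'i \<Rightarrow> real" where
  "alt Z \<beta> \<gamma> = Z \<beta> \<gamma> - Z \<gamma> \<beta>"

end

(* The jet frame is triangular over the coordinate frame, so the components of a field in it are
   globally defined. The brackets of its members are vertical and the connection annihilates the
   frame in vertical directions; hence the curvature components are the usual quadratic expressions
   in the connection coefficients, evaluated by the chain rule along (t, s) and (x, y s). What is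
   left is the total symmetry of the third fibre derivatives of the spray (Schwarz). *)

theory Submission
  imports Defs
begin

text \<open>\<open>frechet_derivative\<close>, and with it \<open>pd\<close>, is a total operator,
  unspecified where a function is not differentiable, so the derivative rules need smoothness first.
  It is shown for the spray: positive definiteness makes the fundamental tensor invertible, Cramer's
  rule makes the inverse a quotient of smooth functions, and the remaining coefficients are built
  from derivatives of the spray. The shape of the formulas reflects a mismatch of frames. The T
  fields of the jet frame project to coordinate fields on TM, not to delta/delta t; writing d/dt as
  delta/delta t + N d/ds produces the terms P N beside R. On TN the field for x^k projects to d/dx^k
  minus B^r_{kp} y^p_b s^b d/dy^r, whereas the Berwald curvature has N^r_k in that place; the
  difference gives the extra terms with three x directions. The coefficients on the X fields are
  minus the transpose of Gamma with its lower indices exchanged. By Schwarz, Gamma is symmetric in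
  them apart from N^c_{\<alpha>:\<beta>}; hence the X families with a Greek (D) and a Latin (A)
  carry N_{\<beta>:\<epsilon>} where the T families have N_{\<epsilon>:\<beta>}.\<close>

section \<open>Calculus of smooth functions\<close>

text \<open>At a point of an open set the derivative depends only on nearby values. This is needed
  because the derivative formulas below hold on \<open>S\<close> only, while the functions are
  total.\<close>

lemma Ck_on_cong:
  assumes "open S" "\<And>x. x \<in> S \<Longrightarrow> f x = g x" "Ck_on k f S"
  shows "Ck_on k g S"
  using assms(2,3)
proof (induction k arbitrary: f g)
  case 0
  then show ?case using continuous_on_cong by (metis Ck_on.simps(1))
next
  case (Suc k)
  have d: "(g has_derivative frechet_derivative f (at x)) (at x)" if "x \<in> S" for x
    using Suc.prems that \<open>open S\<close>
    by (metis Ck_on.simps(2) frechet_derivative_works has_derivative_transform_within_open)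
  then have "frechet_derivative f (at x) = frechet_derivative g (at x)" if "x \<in> S" for x
    using that frechet_derivative_at by blast
  then have "Ck_on k (\<lambda>x. frechet_derivative g (at x) v) S" for v
    using Suc.prems(2) Suc.IH[of "\<lambda>x. frechet_derivative f (at x) v" "\<lambda>x. frechet_derivative g (at x) v"]
    by simp
  then show ?case using d unfolding Ck_on.simps(2) differentiable_def by blast
qed

text \<open>Used in the product and inverse rules, where undifferentiated factors stand beside
  derivatives that have one order less.\<close>

lemma Ck_on_SucD: "Ck_on (Suc k) f S \<Longrightarrow> Ck_on k f S"
proof (induction k arbitrary: f)
  case 0
  then show ?case
    by (simp add: continuous_at_imp_continuous_on differentiable_imp_continuous_within)
next
  case (Suc k)
  from Suc.prems have 1: "\<forall>x\<in>S. f differentiable (at x)"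
    and 2: "\<forall>v. Ck_on (Suc k) (\<lambda>x. frechet_derivative f (at x) v) S"
    unfolding Ck_on.simps(2)[of "Suc k"] by simp_all
  have "Ck_on k (\<lambda>x. frechet_derivative f (at x) v) S" for v
    using Suc.IH 2 by simp
  with 1 show ?case unfolding Ck_on.simps(2) by simp
qed

lemma Ck_on_const: "Ck_on k (\<lambda>_. c) S"
  by (induction k arbitrary: c) simp_all

lemma Ck_on_bounded_linear: "bounded_linear f \<Longrightarrow> Ck_on k f S"
proof (cases k)
  case 0
  then show "bounded_linear f \<Longrightarrow> ?thesis"
    by (simp add: bounded_linear.linear linear_continuous_on)
next
  case (Suc m)
  assume f: "bounded_linear f"
  then have d: "(f has_derivative f) (at x)" for x
    by (rule bounded_linear_imp_has_derivative)
  then have "frechet_derivative f (at x) = f" for x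
    by (metis frechet_derivative_at)
  then show ?thesis using d Suc by (auto simp: Ck_on_const differentiable_def)
qed

lemma Ck_on_add:
  assumes "open S" "Ck_on k f S" "Ck_on k g S"
  shows "Ck_on k (\<lambda>x. f x + g x) S"
  using assms(2,3)
proof (induction k arbitrary: f g)
  case 0
  then show ?case by (simp add: continuous_on_add)
next
  case (Suc k)
  let ?D = "\<lambda>f x. frechet_derivative f (at x)"
  have d: "((\<lambda>x. f x + g x) has_derivative (\<lambda>h. ?D f x h + ?D g x h)) (at x)" if "x \<in> S" for x
    using Suc.prems that by (intro derivative_intros) (auto simp: frechet_derivative_works)
  then have "?D (\<lambda>x. f x + g x) x = (\<lambda>h. ?D f x h + ?D g x h)" if "x \<in> S" for x
    using that by (intro frechet_derivative_at[symmetric]) auto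
  moreover have "Ck_on k (\<lambda>x. ?D f x v + ?D g x v) S" for v
    using Suc by auto
  ultimately have "Ck_on k (\<lambda>x. ?D (\<lambda>x. f x + g x) x v) S" for v
    by (intro Ck_on_cong[OF \<open>open S\<close> _ \<open>Ck_on k (\<lambda>x. ?D f x v + ?D g x v) S\<close>]) simp
  then show ?case using d by (auto simp: differentiable_def)
qed

lemma Ck_on_mult:
  fixes f g :: "'a::real_normed_vector \<Rightarrow> real"
  assumes "open S" "Ck_on k f S" "Ck_on k g S"
  shows "Ck_on k (\<lambda>x. f x * g x) S"
  using assms(2,3)
proof (induction k arbitrary: f g)
  case 0
  then show ?case by (simp add: continuous_on_mult)
next
  case (Suc k)
  let ?D = "\<lambda>f x. frechet_derivative f (at x)"
  have d: "((\<lambda>x. f x * g x) has_derivative (\<lambda>h. f x * ?D g x h + ?D f x h * g x)) (at x)"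
    if "x \<in> S" for x
    using Suc.prems that by (intro has_derivative_mult) (auto simp: frechet_derivative_works)
  then have "?D (\<lambda>x. f x * g x) x = (\<lambda>h. f x * ?D g x h + ?D f x h * g x)" if "x \<in> S" for x
    using that by (intro frechet_derivative_at[symmetric]) auto
  moreover have "Ck_on k (\<lambda>x. f x * ?D g x v + ?D f x v * g x) S" for v
    using Suc.prems Ck_on_SucD[OF Suc.prems(1)] Ck_on_SucD[OF Suc.prems(2)]
    by (intro Ck_on_add \<open>open S\<close> Suc.IH) auto
  ultimately have "Ck_on k (\<lambda>x. ?D (\<lambda>x. f x * g x) x v) S" for v
    by (intro Ck_on_cong[OF \<open>open S\<close> _ \<open>Ck_on k (\<lambda>x. f x * ?D g x v + ?D f x v * g x) S\<close>]) simp
  then show ?case using d by (auto simp: differentiable_def)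
qed

text \<open>The derivative of 1/f is -(1/f) f' (1/f): it contains 1/f itself, so the induction on
  the order feeds the previous level back through the product rule.\<close>

lemma Ck_on_inverse:
  fixes f :: "'a::real_normed_vector \<Rightarrow> real"
  assumes "open S" "Ck_on k f S" and nz: "\<And>x. x \<in> S \<Longrightarrow> f x \<noteq> 0"
  shows "Ck_on k (\<lambda>x. inverse (f x)) S"
  using assms(2)
proof (induction k)
  case 0
  then show ?case using nz by (auto intro: continuous_on_inverse)
next
  case (Suc k)
  let ?D = "\<lambda>f x. frechet_derivative f (at x)"
  let ?d = "\<lambda>x h. - (inverse (f x) * ?D f x h * inverse (f x))"
  have d: "((\<lambda>x. inverse (f x)) has_derivative ?d x) (at x)"
    if "x \<in> S" for x
    using Suc.prems that nz by (intro Deriv.has_derivative_inverse) (auto simp: frechet_derivative_works)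
  then have e: "?D (\<lambda>x. inverse (f x)) x = ?d x" if "x \<in> S" for x
    using that by (metis frechet_derivative_at)
  have i: "Ck_on k (\<lambda>x. inverse (f x)) S" using Suc Ck_on_SucD by blast
  have "Ck_on k (\<lambda>x. (- 1) * ((inverse (f x) * ?D f x v) * inverse (f x))) S" for v
    using Suc.prems by (intro Ck_on_mult Ck_on_const i \<open>open S\<close>) auto
  then have "Ck_on k (\<lambda>x. ?D (\<lambda>x. inverse (f x)) x v) S" for v
    by (intro Ck_on_cong[OF \<open>open S\<close> _ \<open>Ck_on k (\<lambda>x. (- 1) * ((inverse (f x) * ?D f x v) * inverse (f x))) S\<close>])
      (simp add: e)
  then show ?case using d by (auto simp: differentiable_def)
qed

lemma smooth_on_cong:
  assumes "open S" "\<And>x. x \<in> S \<Longrightarrow> f x = g x" "smooth_on f S"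
  shows "smooth_on g S"
  using assms(3) Ck_on_cong[OF assms(1), of f g] assms(2) unfolding smooth_on_def by blast

lemma smooth_on_const: "smooth_on (\<lambda>_. c) S"
  by (simp add: smooth_on_def Ck_on_const)

lemma smooth_on_nth: "smooth_on (\<lambda>x. x $ i) S"
  unfolding smooth_on_def by (intro allI Ck_on_bounded_linear bounded_linear_vec_nth)

lemma smooth_on_add:
  "open S \<Longrightarrow> smooth_on f S \<Longrightarrow> smooth_on g S \<Longrightarrow> smooth_on (\<lambda>x. f x + g x) S"
  unfolding smooth_on_def using Ck_on_add[of S _ f g] by simp

lemma smooth_on_mult:
  fixes f g :: "'a::real_normed_vector \<Rightarrow> real"
  shows "open S \<Longrightarrow> smooth_on f S \<Longrightarrow> smooth_on g S \<Longrightarrow> smooth_on (\<lambda>x. f x * g x) S"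
  unfolding smooth_on_def using Ck_on_mult[of S _ f g] by simp

lemma smooth_on_diff:
  fixes f g :: "'a::real_normed_vector \<Rightarrow> real"
  assumes "open S" "smooth_on f S" "smooth_on g S"
  shows "smooth_on (\<lambda>x. f x - g x) S"
  using smooth_on_add[OF assms(1,2) smooth_on_mult[OF assms(1) smooth_on_const[of "- 1"] assms(3)]]
  by simp

lemma smooth_on_divide:
  fixes f g :: "'a::real_normed_vector \<Rightarrow> real"
  assumes "open S" "smooth_on f S" "smooth_on g S" "\<And>x. x \<in> S \<Longrightarrow> g x \<noteq> 0"
  shows "smooth_on (\<lambda>x. f x / g x) S"
  using assms Ck_on_inverse[of S _ g] smooth_on_mult[of S f "\<lambda>x. inverse (g x)"]
  unfolding divide_inverse smooth_on_def by simp

lemma smooth_on_sum: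
  assumes "open S" "\<And>i. i \<in> I \<Longrightarrow> smooth_on (f i) S"
  shows "smooth_on (\<lambda>x. \<Sum>i\<in>I. f i x) S"
  using assms(2) by (induction I rule: infinite_finite_induct)
    (simp_all add: smooth_on_const smooth_on_add[OF \<open>open S\<close>])

lemma smooth_on_prod:
  fixes f :: "'i \<Rightarrow> 'a::real_normed_vector \<Rightarrow> real"
  assumes "open S" "\<And>i. i \<in> I \<Longrightarrow> smooth_on (f i) S"
  shows "smooth_on (\<lambda>x. \<Prod>i\<in>I. f i x) S"
  using assms(2) by (induction I rule: infinite_finite_induct)
    (simp_all add: smooth_on_const smooth_on_mult[OF \<open>open S\<close>])

lemma smooth_on_pd: "smooth_on f S \<Longrightarrow> smooth_on (pd I f) S"
  unfolding smooth_on_def pd_def[abs_def] by (metis Ck_on.simps(2))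

lemma smooth_on_imp_has_derivative:
  "smooth_on f S \<Longrightarrow> x \<in> S \<Longrightarrow> (f has_derivative frechet_derivative f (at x)) (at x)"
  unfolding smooth_on_def by (metis Ck_on.simps(2) frechet_derivative_works)

text \<open>Allows an identity valid only on \<open>S\<close>, such as a symmetry coming from
  Schwarz, to be differentiated once more.\<close>

lemma pd_transform:
  assumes "open S" "u \<in> S" "smooth_on f S" "\<And>x. x \<in> S \<Longrightarrow> f x = g x"
  shows "pd I f u = pd I g u"
proof -
  have "(g has_derivative frechet_derivative f (at u)) (at u)"
    by (rule has_derivative_transform_within_open[OF smooth_on_imp_has_derivative[OF assms(3,2)] assms(1,2)])
      (rule assms(4))
  then show ?thesis
    unfolding pd_def by (simp add: frechet_derivative_at[symmetric])
qed

lemma frechet_derivative_pd: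
  assumes "(f has_derivative frechet_derivative f (at u)) (at u)"
  shows "frechet_derivative f (at u) v = (\<Sum>I\<in>UNIV. v $ I * pd I f u)"
proof -
  interpret linear "frechet_derivative f (at u)"
    using assms has_derivative_linear by blast
  have "frechet_derivative f (at u) v = frechet_derivative f (at u) (\<Sum>I\<in>UNIV. v $ I *\<^sub>R axis I 1)"
    by (simp add: basis_expansion[of v, unfolded scalar_mult_eq_scaleR])
  then show ?thesis by (simp add: sum scale pd_def)
qed

section \<open>Smooth dependence of the inverse matrix on its entries\<close>

lemma smooth_on_det:
  fixes A :: "'n::finite \<Rightarrow> 'n \<Rightarrow> 'a::real_normed_vector \<Rightarrow> real"
  assumes "open S" "\<And>i j. smooth_on (A i j) S"
  shows "smooth_on (\<lambda>x. det (\<chi> i j. A i j x)) S"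
  unfolding det_def using assms by (auto intro!: smooth_on_sum smooth_on_mult smooth_on_prod smooth_on_const)

text \<open>\<open>matrix_inv\<close> is defined by choice and cannot be differentiated as it
  stands. Its column \<open>l\<close> solves A x = e_l, so Cramer's rule gives each entry as a
  quotient of polynomials in the entries of \<open>A\<close>.\<close>

lemma matrix_inv_cramer:
  fixes A :: "real^'n::finite^'n"
  assumes "invertible A"
  shows "matrix_inv A $ k $ l = det (\<chi> i j. if j = k then axis l 1 $ i else A $ i $ j) / det A"
proof -
  have "det A \<noteq> 0" using assms by (simp add: invertible_det_nz)
  moreover have "A *v (matrix_inv A *v axis l 1) = axis l 1"
    using someI_ex[OF assms[unfolded invertible_def]]
    by (simp add: matrix_vector_mul_assoc matrix_inv_def)
  ultimately have "matrix_inv A *v axis l 1 =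
      (\<chi> k. det (\<chi> i j. if j = k then axis l 1 $ i else A $ i $ j) / det A)"
    using cramer by blast
  then show ?thesis by (simp add: matrix_vector_mult_basis column_def vec_eq_iff)
qed

lemma smooth_on_matrix_inv:
  fixes A :: "'n::finite \<Rightarrow> 'n \<Rightarrow> 'a::real_normed_vector \<Rightarrow> real"
  assumes "open S" "\<And>i j. smooth_on (A i j) S" "\<And>x. x \<in> S \<Longrightarrow> invertible (\<chi> i j. A i j x)"
  shows "smooth_on (\<lambda>x. matrix_inv (\<chi> i j. A i j x) $ k $ l) S"
proof (rule smooth_on_cong[OF \<open>open S\<close>])
  \<comment> \<open>The replaced column is written as constant functions inside the family of
    entries, which is the form that \<open>smooth_on_det\<close> accepts.\<close>
  show "smooth_on (\<lambda>x. det (\<chi> i j. (if j = k then (\<lambda>_. axis l 1 $ i) else A i j) x)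
        / det (\<chi> i j. A i j x)) S"
    using assms by (intro smooth_on_divide smooth_on_det)
      (auto simp: invertible_det_nz smooth_on_const)
  fix x assume "x \<in> S"
  then show "det (\<chi> i j. (if j = k then (\<lambda>_. axis l 1 $ i) else A i j) x)
        / det (\<chi> i j. A i j x) = matrix_inv (\<chi> i j. A i j x) $ k $ l"
    using assms(3) by (simp add: matrix_inv_cramer if_distrib[of "\<lambda>f. f x"] cong: if_cong)
qed

text \<open>The quadratic form of \<open>A\<close> vanishes on the kernel of \<open>A\<close>, so
  positivity forces the kernel to be zero.\<close>

lemma pos_def_invertible:
  fixes A :: "real^'n::finite^'n"
  assumes "\<And>w. w \<noteq> 0 \<Longrightarrow> (\<Sum>i\<in>UNIV. \<Sum>j\<in>UNIV. A $ i $ j * w $ i * w $ j) > 0"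
  shows "invertible A"
proof -
  have "w = 0" if "A *v w = 0" for w
  proof (rule ccontr)
    assume "w \<noteq> 0"
    then have "0 < (\<Sum>i\<in>UNIV. w $ i * (A *v w) $ i)"
      using assms[of w] by (simp add: matrix_vector_mult_def sum_distrib_left mult_ac)
    with that show False by simp
  qed
  then show ?thesis
    by (simp add: invertible_left_inverse matrix_left_invertible_ker)
qed

section \<open>Schwarz's theorem for second derivatives\<close>

text \<open>The left-hand side is symmetric in \<open>v\<close> and \<open>w\<close>; this is the source of Schwarz's theorem below.\<close>

lemma mixed_second_difference:
  fixes f :: "'a::real_normed_vector \<Rightarrow> real"
  assumes C: "Ck_on 2 f S" and h: "h > 0"
    and S: "\<And>a b. a \<in> {0..h} \<Longrightarrow> b \<in> {0..h} \<Longrightarrow> u + a *\<^sub>R v + b *\<^sub>R w \<in> S"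
  shows "\<exists>a\<in>{0..h}. \<exists>b\<in>{0..h}. f (u + h *\<^sub>R v + h *\<^sub>R w) - f (u + h *\<^sub>R v) - f (u + h *\<^sub>R w) + f u =
    h * (h * frechet_derivative (\<lambda>x. frechet_derivative f (at x) v) (at (u + a *\<^sub>R v + b *\<^sub>R w)) w)"
proof -
  let ?D = "\<lambda>f x. frechet_derivative f (at x)"
  have C1: "Ck_on (Suc 0) (\<lambda>x. ?D f x v) S" and d0: "\<And>x. x \<in> S \<Longrightarrow> f differentiable (at x)"
    using C by (auto simp: numeral_2_eq_2)
  have d1: "(g has_derivative ?D g x) (at x)" if "x \<in> S" "g = f \<or> g = (\<lambda>x. ?D f x v)" for g x
    using that C1 d0 by (auto simp: frechet_derivative_works)
  have lin: "linear (?D g x)" if "x \<in> S" "g = f \<or> g = (\<lambda>x. ?D f x v)" for g x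
    using d1[OF that] has_derivative_linear by blast
  have da: "((\<lambda>a. f (u + a *\<^sub>R v + b *\<^sub>R w)) has_real_derivative ?D f (u + a *\<^sub>R v + b *\<^sub>R w) v) (at a)"
    if "a \<in> {0..h}" "b \<in> {0..h}" for a b
  proof -
    have "((\<lambda>a. u + a *\<^sub>R v + b *\<^sub>R w) has_derivative (\<lambda>t. t *\<^sub>R v)) (at a)"
      by (auto intro!: derivative_eq_intros)
    from has_derivative_compose[OF this d1[OF S[OF that], of f]]
    show ?thesis using lin[OF S[OF that], of f]
      by (simp add: has_field_derivative_def linear_scale mult_commute_abs)
  qed
  have db: "((\<lambda>b. ?D f (u + a *\<^sub>R v + b *\<^sub>R w) v) has_real_derivative
      ?D (\<lambda>x. ?D f x v) (u + a *\<^sub>R v + b *\<^sub>R w) w) (at b)"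
    if "a \<in> {0..h}" "b \<in> {0..h}" for a b
  proof -
    have "((\<lambda>b. u + a *\<^sub>R v + b *\<^sub>R w) has_derivative (\<lambda>t. t *\<^sub>R w)) (at b)"
      by (auto intro!: derivative_eq_intros)
    from has_derivative_compose[OF this d1[OF S[OF that], of "\<lambda>x. ?D f x v"]]
    show ?thesis using lin[OF S[OF that], of "\<lambda>x. ?D f x v"]
      by (simp add: has_field_derivative_def linear_scale mult_commute_abs)
  qed
  \<comment> \<open>First mean value theorem, along \<open>v\<close>, for the difference of
    \<open>f\<close> across the side \<open>h\<close> in direction \<open>w\<close>. The term with
    factor 0 keeps the shape of \<open>da\<close> at b = 0.\<close>
  have "((\<lambda>a. f (u + a *\<^sub>R v + h *\<^sub>R w) - f (u + a *\<^sub>R v + 0 *\<^sub>R w)) has_real_derivative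
      ?D f (u + a *\<^sub>R v + h *\<^sub>R w) v - ?D f (u + a *\<^sub>R v + 0 *\<^sub>R w) v) (at a)"
    if "0 \<le> a" "a \<le> h" for a
    using that h by (intro DERIV_diff da) auto
  from MVT2[OF h this] obtain a where a: "0 < a" "a < h" and
    1: "f (u + h *\<^sub>R v + h *\<^sub>R w) - f (u + h *\<^sub>R v) - (f (u + h *\<^sub>R w) - f u) =
      h * (?D f (u + a *\<^sub>R v + h *\<^sub>R w) v - ?D f (u + a *\<^sub>R v + 0 *\<^sub>R w) v)"
    by auto
  \<comment> \<open>Second mean value theorem, along \<open>w\<close>, for the
    \<open>v\<close>-derivative with \<open>a\<close> now fixed.\<close>
  have "((\<lambda>b. ?D f (u + a *\<^sub>R v + b *\<^sub>R w) v) has_real_derivative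
      ?D (\<lambda>x. ?D f x v) (u + a *\<^sub>R v + b *\<^sub>R w) w) (at b)" if "0 \<le> b" "b \<le> h" for b
    using that a by (intro db) auto
  from MVT2[OF h this] obtain b where b: "0 < b" "b < h" and
    2: "?D f (u + a *\<^sub>R v + h *\<^sub>R w) v - ?D f (u + a *\<^sub>R v + 0 *\<^sub>R w) v =
      h * ?D (\<lambda>x. ?D f x v) (u + a *\<^sub>R v + b *\<^sub>R w) w"
    by auto
  from 1 2 have "f (u + h *\<^sub>R v + h *\<^sub>R w) - f (u + h *\<^sub>R v) - f (u + h *\<^sub>R w) + f u =
    h * (h * ?D (\<lambda>x. ?D f x v) (u + a *\<^sub>R v + b *\<^sub>R w) w)" by simp
  then show ?thesis using a b by (intro bexI[of _ a] bexI[of _ b]) auto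
qed

text \<open>Divided by h^2, the same second difference equals one mixed derivative at some point of
  a small parallelogram and the other mixed derivative at another point of it. Both derivatives are
  continuous at \<open>u\<close>, so different values there are impossible.\<close>

lemma frechet_derivative_commute:
  fixes f :: "'a::real_normed_vector \<Rightarrow> real"
  assumes "open S" "u \<in> S" and C: "Ck_on 2 f S"
  shows "frechet_derivative (\<lambda>x. frechet_derivative f (at x) v) (at u) w =
    frechet_derivative (\<lambda>x. frechet_derivative f (at x) w) (at u) v"
proof (rule ccontr)
  define E where "E = (\<lambda>v w x. frechet_derivative (\<lambda>x. frechet_derivative f (at x) v) (at x) w)"
  have cont: "continuous_on S (E v w)" for v w
    using C by (simp add: E_def numeral_2_eq_2)
  assume "\<not> ?thesis"
  then have ne: "E v w u \<noteq> E w v u" by (simp add: E_def)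
  \<comment> \<open>Half the gap: no number can lie at distance less than \<open>e\<close> from both
    values.\<close>
  define e where "e = dist (E v w u) (E w v u) / 2"
  have e: "e > 0" using ne by (simp add: e_def)
  have "\<forall>\<^sub>F x in nhds u. x \<in> S \<and> dist (E v w x) (E v w u) < e \<and> dist (E w v x) (E w v u) < e"
  proof -
    have "isCont (E v w) u" "isCont (E w v) u"
      using cont assms by (simp_all add: continuous_on_eq_continuous_at)
    then have "(E v w \<longlongrightarrow> E v w u) (nhds u)" "(E w v \<longlongrightarrow> E w v u) (nhds u)"
      by (simp_all add: continuous_at_imp_continuous_within isCont_def tendsto_at_iff_tendsto_nhds)
    from tendstoD[OF this(1) e] tendstoD[OF this(2) e] eventually_nhds_in_open[OF assms(1,2)]
    show ?thesis by eventually_elim auto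
  qed
  then obtain r where r: "r > 0" and near: "\<And>x. dist x u < r \<Longrightarrow>
      x \<in> S \<and> dist (E v w x) (E v w u) < e \<and> dist (E w v x) (E w v u) < e"
    unfolding eventually_nhds_metric by blast
  \<comment> \<open>The summand 1 keeps \<open>c\<close> positive when both vectors vanish; the
    choice of \<open>h\<close> keeps the parallelogram within distance r/2 of
    \<open>u\<close>.\<close>
  define c where "c = 1 + norm v + norm w"
  define h where "h = r / (2 * c)"
  have nn: "c > 0" by (simp add: c_def add_pos_nonneg)
  have h: "h > 0" using r nn by (simp add: h_def)
  have small: "dist (u + a *\<^sub>R v + b *\<^sub>R w) u < r" if "a \<in> {0..h}" "b \<in> {0..h}" for a b
  proof -
    have "dist (u + a *\<^sub>R v + b *\<^sub>R w) u = norm (a *\<^sub>R v + b *\<^sub>R w)" by (simp add: dist_norm)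
    also have "\<dots> \<le> a * norm v + b * norm w" using that norm_triangle_ineq[of "a *\<^sub>R v" "b *\<^sub>R w"] by simp
    also have "\<dots> \<le> h * norm v + h * norm w" using that by (intro add_mono mult_right_mono) auto
    also have "\<dots> \<le> h * c" using h by (simp add: c_def algebra_simps)
    also have "\<dots> = r / 2" using nn by (simp add: h_def)
    also have "\<dots> < r" using r by simp
    finally show ?thesis .
  qed
  obtain a b where ab: "a \<in> {0..h}" "b \<in> {0..h}"
    "f (u + h *\<^sub>R v + h *\<^sub>R w) - f (u + h *\<^sub>R v) - f (u + h *\<^sub>R w) + f u =
      h * (h * E v w (u + a *\<^sub>R v + b *\<^sub>R w))"
    using mixed_second_difference[OF C h, of u v w] small near unfolding E_def by metis
  have small': "dist (u + a *\<^sub>R w + b *\<^sub>R v) u < r" if "a \<in> {0..h}" "b \<in> {0..h}" for a b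
    using small[OF that(2,1)] by (simp add: add_ac)
  obtain a' b' where ab': "a' \<in> {0..h}" "b' \<in> {0..h}"
    "f (u + h *\<^sub>R w + h *\<^sub>R v) - f (u + h *\<^sub>R w) - f (u + h *\<^sub>R v) + f u =
      h * (h * E w v (u + a' *\<^sub>R w + b' *\<^sub>R v))"
    using mixed_second_difference[OF C h, of u w v] small' near unfolding E_def by metis
  have "E v w (u + a *\<^sub>R v + b *\<^sub>R w) = E w v (u + a' *\<^sub>R w + b' *\<^sub>R v)"
  proof -
    have "h * (h * E v w (u + a *\<^sub>R v + b *\<^sub>R w)) = h * (h * E w v (u + a' *\<^sub>R w + b' *\<^sub>R v))"
      unfolding ab(3)[symmetric] ab'(3)[symmetric] by (simp add: algebra_simps)
    then show ?thesis using h by simp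
  qed
  moreover have "dist (E v w (u + a *\<^sub>R v + b *\<^sub>R w)) (E v w u) < e"
    "dist (E w v (u + a' *\<^sub>R w + b' *\<^sub>R v)) (E w v u) < e"
    using near small[OF ab(1,2)] small'[OF ab'(1,2)] by blast+
  ultimately show False
    unfolding e_def using dist_triangle_half_r by (metis dist_commute order_less_irrefl)
qed

lemma pd_commute:
  assumes "open S" "u \<in> S" "smooth_on f S"
  shows "pd I (pd J f) u = pd J (pd I f) u"
  using frechet_derivative_commute[OF assms(1,2)] assms(3)
  unfolding pd_def[abs_def] smooth_on_def by blast

section \<open>The Berwald connection in coordinates\<close>

lemma sum_UNIV_sum_type:
  fixes f :: "'i::finite + 'j::finite \<Rightarrow> 'c::comm_monoid_add"
  shows "(\<Sum>I\<in>UNIV. f I) = (\<Sum>i\<in>UNIV. f (Inl i)) + (\<Sum>j\<in>UNIV. f (Inr j))"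
  by (simp add: UNIV_Plus_UNIV[symmetric] sum.Plus o_def del: UNIV_Plus_UNIV)

lemma continuous_on_base_part: "continuous_on UNIV base_part"
  unfolding base_part_def[abs_def] by (intro continuous_intros)

lemma continuous_on_fibre_part: "continuous_on UNIV fibre_part"
  unfolding fibre_part_def[abs_def] by (intro continuous_intros)

lemma open_slit_dom:
  assumes "is_chart M c"
  shows "open (slit_dom c)"
proof -
  have eq: "slit_dom c = base_part -` (snd c ` fst c) \<inter> fibre_part -` (- {0})"
    by (auto simp: slit_dom_def)
  have "open (base_part -` (snd c ` fst c))"
    using assms by (intro open_vimage continuous_on_base_part) (simp add: is_chart_def)
  moreover have "open (fibre_part -` (- {0}))"
    by (intro open_vimage continuous_on_fibre_part open_Compl closed_singleton)
  ultimately show ?thesis unfolding eq by (rule open_Int)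
qed

section \<open>Smoothness of the spray and symmetry of its fibre derivatives\<close>

lemma smooth_on_fund_tensor:
  assumes "open S" "smooth_on L S"
  shows "smooth_on (fund_tensor L \<alpha> \<beta>) S"
  unfolding fund_tensor_def[abs_def] power2_eq_square
  by (intro smooth_on_mult smooth_on_pd smooth_on_const assms)

lemma smooth_on_spray_if_invertible:
  assumes "open S" "smooth_on L S"
    and inv: "\<And>u. u \<in> S \<Longrightarrow> invertible (\<chi> \<alpha> \<beta>. fund_tensor L \<alpha> \<beta> u)"
  shows "smooth_on (spray L \<mu>) S"
proof -
  note g = smooth_on_fund_tensor[OF assms(1,2)]
  have "smooth_on (fund_inv L \<alpha> \<beta>) S" for \<alpha> \<beta>
    unfolding fund_inv_def[abs_def] by (intro smooth_on_matrix_inv assms g)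
  then have "smooth_on (christoffel L \<mu> \<alpha> \<beta>) S" for \<mu> \<alpha> \<beta>
    unfolding christoffel_def[abs_def]
    by (intro smooth_on_sum smooth_on_mult smooth_on_divide smooth_on_diff smooth_on_add smooth_on_pd
        smooth_on_const g assms(1)) simp_all
  then show ?thesis
    unfolding spray_def[abs_def]
    by (intro smooth_on_sum smooth_on_mult smooth_on_const smooth_on_nth assms(1))
qed

text \<open>The interface between Finsler geometry and the curvature computation: N, B, R and P are
  all formed from the spray by differentiation and arithmetic. It is instantiated once for each of
  the two manifolds.\<close>

locale smooth_spray =
  fixes L :: "real^('p::finite + 'p) \<Rightarrow> real" and S
  assumes open_S: "open S" and smooth_on_spray: "smooth_on (spray L \<mu>) S"
begin

lemma smooth_on_nonlin: "smooth_on (nonlin L \<gamma> \<alpha>) S"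
  unfolding nonlin_def by (intro smooth_on_pd smooth_on_spray)

lemma smooth_on_berwald: "smooth_on (berwald L \<gamma> \<alpha> \<beta>) S"
  unfolding berwald_def by (intro smooth_on_pd smooth_on_spray)

lemma smooth_on_nonlin_cov: "smooth_on (nonlin_cov L \<gamma> \<alpha> \<beta>) S"
  unfolding nonlin_cov_def[abs_def]
  by (intro smooth_on_diff smooth_on_add smooth_on_sum smooth_on_mult smooth_on_pd
      smooth_on_nonlin smooth_on_berwald open_S)

lemma berwald_commute: "u \<in> S \<Longrightarrow> berwald L \<gamma> \<alpha> \<beta> u = berwald L \<gamma> \<beta> \<alpha> u"
  unfolding berwald_def by (rule pd_commute[OF open_S _ smooth_on_spray])

lemma pd_berwald_commute: "u \<in> S \<Longrightarrow> pd I (berwald L \<gamma> \<alpha> \<beta>) u = pd I (berwald L \<gamma> \<beta> \<alpha>) u"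
  by (rule pd_transform[OF open_S _ smooth_on_berwald berwald_commute])

text \<open>The two outer derivatives of the triple fibre derivative commute, which exchanges the
  first and third lower indices; the first two are exchanged by the symmetry of B. These two
  transpositions generate the exchange of the last two.\<close>

lemma berwald_P_commute:
  assumes "u \<in> S"
  shows "berwald_P L \<delta> \<alpha> \<beta> \<gamma> u = berwald_P L \<delta> \<beta> \<alpha> \<gamma> u"
    and "berwald_P L \<delta> \<alpha> \<beta> \<gamma> u = berwald_P L \<delta> \<alpha> \<gamma> \<beta> u"
proof -
  show 1: "berwald_P L \<delta> \<alpha> \<beta> \<gamma> u = berwald_P L \<delta> \<beta> \<alpha> \<gamma> u" for \<alpha> \<beta> \<gamma>
    unfolding berwald_P_def by (rule pd_berwald_commute[OF assms])
  have "berwald_P L \<delta> \<alpha> \<beta> \<gamma> u = berwald_P L \<delta> \<gamma> \<beta> \<alpha> u" for \<alpha> \<beta> \<gamma>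
    unfolding berwald_P_def berwald_def
    by (rule pd_commute[OF open_S assms smooth_on_pd[OF smooth_on_spray]])
  then show "berwald_P L \<delta> \<alpha> \<beta> \<gamma> u = berwald_P L \<delta> \<alpha> \<gamma> \<beta> u"
    using 1 by metis
qed

end

lemma smooth_spray_chart_rep:
  assumes "finsler_manifold M \<A> F" "c \<in> \<A>"
  shows "smooth_spray (chart_rep \<A> F c) (slit_dom c)"
proof
  show o: "open (slit_dom c)"
    using assms by (auto simp: finsler_manifold_def smooth_manifold_def intro: open_slit_dom)
  show "smooth_on (spray (chart_rep \<A> F c) \<mu>) (slit_dom c)" for \<mu>
    using assms by (intro smooth_on_spray_if_invertible[OF o] pos_def_invertible) (auto simp: finsler_manifold_def)
qed

section \<open>Linear connections in a triangular frame\<close>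

text \<open>The common shape of \<open>tm_frame\<close> and \<open>jet_frame\<close>; \<open>V\<close> is the set of vertical indices.\<close>

locale triangular_frame =
  fixes e :: "'k::finite \<Rightarrow> 'k vfield" and V :: "'k set"
  assumes vertical: "K \<in> V \<Longrightarrow> e K u = axis K 1"
    and horizontal: "J \<notin> V \<Longrightarrow> I \<notin> V \<Longrightarrow> e I u $ J = (if I = J then 1 else 0)"
begin

lemma sum_frame_nth:
  "(\<Sum>I\<in>UNIV. c I *\<^sub>R e I u) $ K = (if K \<in> V then c K + (\<Sum>I\<in>-V. c I * e I u $ K) else c K)"
proof -
  have V: "(\<Sum>I\<in>V. c I * e I u $ K) = (if K \<in> V then c K else 0)"
    by (simp add: vertical axis_def if_distrib[of "\<lambda>x. _ * x"] cong: if_cong sum.cong)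
  have "(\<Sum>I\<in>UNIV. c I *\<^sub>R e I u) $ K = (\<Sum>I\<in>V. c I * e I u $ K) + (\<Sum>I\<in>-V. c I * e I u $ K)"
    using sum.union_disjoint[of V "-V" "\<lambda>I. c I * e I u $ K"] by simp
  moreover have "(\<Sum>I\<in>-V. c I * e I u $ K) = c K" if "K \<notin> V"
  proof -
    have "(\<Sum>I\<in>-V. c I * e I u $ K) = (\<Sum>I\<in>-V. if I = K then c K else 0)"
      using that by (intro sum.cong) (auto simp: horizontal)
    then show ?thesis using that by simp
  qed
  ultimately show ?thesis using V by simp
qed

text \<open>Solved in two stages: coordinates outside \<open>V\<close> give the horizontal
  coefficients, and once these vanish a coordinate in \<open>V\<close> is its own
  coefficient.\<close>

lemma independent: "(\<Sum>I\<in>UNIV. c I *\<^sub>R e I u) = 0 \<Longrightarrow> c = (\<lambda>_. 0)"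
proof
  fix K
  assume 0: "(\<Sum>I\<in>UNIV. c I *\<^sub>R e I u) = 0"
  then have c: "c I = 0" if "I \<notin> V" for I
    using that sum_frame_nth[of c u I] by simp
  then show "c K = 0"
    using 0 sum_frame_nth[of c u K] by (cases "K \<in> V") simp_all
qed

lemma frame_comp_sum: "frame_comp e u (\<Sum>I\<in>UNIV. c I *\<^sub>R e I u) = c"
  by (rule frame_comp_eq[OF independent refl])

lemma frame_comp_frame: "frame_comp e u (e J u) = (\<lambda>K. if K = J then 1 else 0)"
  using frame_comp_sum[of u "\<lambda>K. if K = J then 1 else 0"]
  by (simp add: if_distrib[of "\<lambda>r. r *\<^sub>R _"] cong: if_cong)

text \<open>Back substitution: horizontal coefficients are plain coordinates, and what the
  horizontal members contribute to a vertical coordinate is subtracted from it.\<close>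

lemma frame_comp_nth:
  "frame_comp e u v K = (if K \<in> V then v $ K - (\<Sum>I\<in>-V. v $ I * e I u $ K) else v $ K)"
proof -
  define c where "c K = (if K \<in> V then v $ K - (\<Sum>I\<in>-V. v $ I * e I u $ K) else v $ K)" for K
  have "(\<Sum>I\<in>UNIV. c I *\<^sub>R e I u) = v"
    by (simp add: vec_eq_iff sum_frame_nth del: sum_component) (simp add: c_def)
  then have "frame_comp e u v = c" using frame_comp_sum[of u c] by simp
  then show ?thesis by (simp add: c_def)
qed

lemma frame_conn_frame_UNIV: "frame_conn e \<omega> (e J) (e I) = (\<lambda>u. \<Sum>K\<in>UNIV. \<omega> K I J u *\<^sub>R e K u)"
  by (rule ext, rule frame_conn_frame[OF open_UNIV UNIV_I]) (rule independent)

text \<open>The structure equation of a connection in a frame that need not commute. The bracket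
  term is kept here because its removal depends on the particular coefficients.\<close>

lemma frame_comp_curvature:
  "frame_comp e u (curvature (frame_conn e \<omega>) (e K) (e J) (e I) u) H =
    frechet_derivative (\<omega> H I J) (at u) (e K u) - frechet_derivative (\<omega> H I K) (at u) (e J u)
    + (\<Sum>M\<in>UNIV. \<omega> H M K u * \<omega> M I J u) - (\<Sum>M\<in>UNIV. \<omega> H M J u * \<omega> M I K u)
    - (\<Sum>M\<in>UNIV. \<omega> H I M u * frame_comp e u (lie_bracket (e K) (e J) u) M)"
proof -
  \<comment> \<open>The field D (e J) (e I) has the component functions \<omega> K I J, so the
    second application of D differentiates exactly these.\<close>
  have second: "frame_conn e \<omega> (e K) (frame_conn e \<omega> (e J) (e I)) u =
      (\<Sum>H\<in>UNIV. (frechet_derivative (\<omega> H I J) (at u) (e K u)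
        + (\<Sum>M\<in>UNIV. \<omega> H M K u * \<omega> M I J u)) *\<^sub>R e H u)" for J K
    unfolding frame_conn_frame_UNIV
    by (simp add: frame_conn_def frame_comp_sum frame_comp_frame
        if_distrib[of "\<lambda>r. _ * r"] cong: if_cong)
  have "frame_conn e \<omega> X (e I) u =
      (\<Sum>H\<in>UNIV. (\<Sum>M\<in>UNIV. \<omega> H I M u * frame_comp e u (X u) M) *\<^sub>R e H u)" for X
  proof -
    have "(\<Sum>I'\<in>UNIV. \<Sum>J\<in>UNIV. \<omega> H I' J u * (if I' = I then 1 else 0) * frame_comp e u (X u) J)
        = (\<Sum>J\<in>UNIV. \<omega> H I J u * frame_comp e u (X u) J)" for H
      by (subst sum.swap) (simp add: if_distrib[of "\<lambda>r. _ * r"] if_distrib[of "\<lambda>r. r * _"] cong: if_cong)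
    then show ?thesis by (simp add: frame_conn_def frame_comp_frame)
  qed
  then have "curvature (frame_conn e \<omega>) (e K) (e J) (e I) u =
      (\<Sum>H\<in>UNIV. (frechet_derivative (\<omega> H I J) (at u) (e K u) - frechet_derivative (\<omega> H I K) (at u) (e J u)
    + (\<Sum>M\<in>UNIV. \<omega> H M K u * \<omega> M I J u) - (\<Sum>M\<in>UNIV. \<omega> H M J u * \<omega> M I K u)
    - (\<Sum>M\<in>UNIV. \<omega> H I M u * frame_comp e u (lie_bracket (e K) (e J) u) M)) *\<^sub>R e H u)"
    unfolding curvature_def second
    by (simp add: sum_subtractf[symmetric] scaleR_diff_left[symmetric] algebra_simps)
  then show ?thesis by (simp only: frame_comp_sum)
qed

text \<open>The horizontal components of the frame fields are constant, so their brackets are vertical.\<close>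

lemma lie_bracket_horizontal:
  assumes "e I differentiable (at u)" "e J differentiable (at u)" "M \<notin> V"
  shows "frame_comp e u (lie_bracket (e I) (e J) u) M = 0"
proof -
  have "frechet_derivative (e I) (at u) v $ M = 0" if "e I differentiable (at u)" for I v
  proof -
    have "((\<lambda>w. e I w $ M) has_derivative (\<lambda>v. frechet_derivative (e I) (at u) v $ M)) (at u)"
      using that bounded_linear.has_derivative[OF bounded_linear_vec_nth]
      unfolding frechet_derivative_works by blast
    moreover have "(\<lambda>w. e I w $ M) = (\<lambda>_. if I \<in> V then 0 else if I = M then 1 else 0)"
      using assms(3) by (auto simp: fun_eq_iff horizontal vertical axis_def)
    ultimately have "(\<lambda>v. frechet_derivative (e I) (at u) v $ M) = (\<lambda>_. 0)"
      using has_derivative_unique[OF _ has_derivative_const] by metis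
    then show ?thesis by meson
  qed
  then show ?thesis using assms by (simp add: frame_comp_nth lie_bracket_def)
qed

end

section \<open>Components of the Berwald connection in the coordinate basis\<close>

lemma triangular_tm_frame: "triangular_frame (tm_frame L) (range Inr)"
proof
  show "tm_frame L K u = axis K 1" if "K \<in> range Inr" for K u using that by auto
  show "tm_frame L I u $ J = (if I = J then 1 else 0)" if "J \<notin> range Inr" "I \<notin> range Inr" for I J u
    using that by (cases I; cases J) (auto simp: axis_def)
qed

text \<open>The plus sign comes from solving for the coordinate field: d/dt^\<alpha> = delta/delta
  t^\<alpha> + N^c_\<alpha> d/ds^c.\<close>

lemma frame_comp_tm_frame [simp]:
  "frame_comp (tm_frame L) u v (Inl \<alpha>) = v $ Inl \<alpha>"
  "frame_comp (tm_frame L) u v (Inr c) = v $ Inr c + (\<Sum>\<alpha>\<in>UNIV. nonlin L c \<alpha> u * v $ Inl \<alpha>)"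
proof -
  interpret triangular_frame "tm_frame L" "range Inr" by (rule triangular_tm_frame)
  show "frame_comp (tm_frame L) u v (Inl \<alpha>) = v $ Inl \<alpha>" by (auto simp: frame_comp_nth)
  have "- range Inr = range (Inl :: 'a \<Rightarrow> 'a + 'a)" by (auto elim: sumE) (metis sumE rangeI)
  then show "frame_comp (tm_frame L) u v (Inr c) = v $ Inr c + (\<Sum>\<alpha>\<in>UNIV. nonlin L c \<alpha> u * v $ Inl \<alpha>)"
    by (simp add: frame_comp_nth sum.reindex axis_def sum_negf mult_ac
        if_distrib[of "\<lambda>r. _ * r"] cong: if_cong)
qed

text \<open>A coordinate field d/dt has the non-constant component N in the adapted frame.
  Differentiating it gives the partial derivatives of N, and returning to coordinates subtracts the
  product of N with the horizontal part; together these make \<open>nonlin_cov\<close>.\<close>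

lemma tm_Gamma_simps:
  "tm_Gamma L (Inl \<gamma>) (Inl \<alpha>) (Inl \<beta>) = berwald L \<gamma> \<alpha> \<beta>"
  "tm_Gamma L (Inr c) (Inl \<alpha>) (Inl \<beta>) = nonlin_cov L c \<alpha> \<beta>"
  "tm_Gamma L (Inr c) (Inr a) (Inl \<beta>) = berwald L c a \<beta>"
  "tm_Gamma L (Inr c) (Inl \<alpha>) (Inr b) = berwald L c b \<alpha>"
  "tm_Gamma L (Inl \<gamma>) (Inr a) B = (\<lambda>_. 0)"
  "tm_Gamma L (Inl \<gamma>) A (Inr b) = (\<lambda>_. 0)"
  "tm_Gamma L C (Inr a) (Inr b) = (\<lambda>_. 0)"
proof -
  interpret triangular_frame "tm_frame L" "range Inr" by (rule triangular_tm_frame)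
  \<comment> \<open>Adapted-frame component \<open>K\<close> of the derivative of d/dT^A along
    d/dT^B; \<open>Inl\<close> and \<open>Inr\<close> below convert it to coordinate
    components.\<close>
  define D where "D K A B u = frechet_derivative (\<lambda>w. frame_comp (tm_frame L) w (axis A 1) K) (at u) (axis B 1)
    + (\<Sum>I\<in>UNIV. \<Sum>J\<in>UNIV. tm_coeff L K I J u * frame_comp (tm_frame L) u (axis A 1) I *
         frame_comp (tm_frame L) u (axis B 1) J)" for K A B u
  have Gamma: "tm_Gamma L C A B u = (\<Sum>K\<in>UNIV. D K A B u *\<^sub>R tm_frame L K u) $ C" for C A B u
    by (simp only: tm_Gamma_def tm_conn_def frame_conn_def D_def)
  have Inl: "tm_Gamma L (Inl \<gamma>) A B u = D (Inl \<gamma>) A B u" for \<gamma> A B u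
    unfolding Gamma sum_frame_nth by auto
  have "- range Inr = range (Inl :: 'a \<Rightarrow> 'a + 'a)" by (auto elim: sumE) (metis sumE rangeI)
  then have Inr: "tm_Gamma L (Inr c) A B u =
      D (Inr c) A B u - (\<Sum>\<gamma>\<in>UNIV. nonlin L c \<gamma> u * D (Inl \<gamma>) A B u)" for c A B u
    unfolding Gamma sum_frame_nth
    by (simp add: sum.reindex axis_def sum_negf mult_ac if_distrib[of "\<lambda>r. _ * r"] cong: if_cong)
  have comp: "frame_comp (tm_frame L) w (axis (Inl \<alpha>) 1) (Inl \<gamma>) = (if \<gamma> = \<alpha> then 1 else 0)"
    "frame_comp (tm_frame L) w (axis (Inl \<alpha>) 1) (Inr c) = nonlin L c \<alpha> w"
    "frame_comp (tm_frame L) w (axis (Inr a) 1) (Inl \<gamma>) = 0"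
    "frame_comp (tm_frame L) w (axis (Inr a) 1) (Inr c) = (if c = a then 1 else 0)" for w \<alpha> \<gamma> a c
    by (simp_all add: axis_def if_distrib[of "\<lambda>r. _ * r"] cong: if_cong)
  have D1: "D (Inl \<gamma>) (Inl \<alpha>) (Inl \<beta>) u = berwald L \<gamma> \<alpha> \<beta> u" for \<gamma> \<alpha> \<beta> u
    by (simp add: D_def sum_UNIV_sum_type comp if_distrib[of "\<lambda>r. _ * r"] if_distrib[of "\<lambda>r. r * _"]
        del: frame_comp_tm_frame cong: if_cong)
  have D2: "D (Inr c) (Inl \<alpha>) (Inl \<beta>) u =
      pd (Inl \<beta>) (nonlin L c \<alpha>) u + (\<Sum>d\<in>UNIV. nonlin L d \<alpha> u * berwald L c d \<beta> u)" for c \<alpha> \<beta> u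
    by (simp add: D_def sum_UNIV_sum_type comp pd_def[symmetric] mult_ac if_distrib[of "\<lambda>r. _ * r"] if_distrib[of "\<lambda>r. r * _"]
        del: frame_comp_tm_frame cong: if_cong)
  have D3: "D (Inr c) (Inr a) (Inl \<beta>) u = berwald L c a \<beta> u" for c a \<beta> u
    by (simp add: D_def sum_UNIV_sum_type comp if_distrib[of "\<lambda>r. _ * r"] if_distrib[of "\<lambda>r. r * _"]
        del: frame_comp_tm_frame cong: if_cong)
  \<comment> \<open>The order \<open>c b \<alpha>\<close> is that of the iterated derivative as it
    arises; exchanging \<open>b\<close> and \<alpha> takes Schwarz and is left for later.\<close>
  have D4: "D (Inr c) (Inl \<alpha>) (Inr b) u = berwald L c b \<alpha> u" for c b \<alpha> u
    by (simp add: D_def sum_UNIV_sum_type comp pd_def[symmetric] nonlin_def berwald_def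
        del: frame_comp_tm_frame)
  have D5: "D (Inl \<gamma>) (Inr a) B u = 0" for \<gamma> a B u
    by (simp add: D_def sum_UNIV_sum_type comp del: frame_comp_tm_frame)
  have D6: "D (Inl \<gamma>) A (Inr b) u = 0" for \<gamma> A b u
    by (cases A) (simp_all add: D_def sum_UNIV_sum_type comp del: frame_comp_tm_frame)
  have D7: "D (Inr c) (Inr a) (Inr b) u = 0" for c a b u
    by (simp add: D_def sum_UNIV_sum_type comp del: frame_comp_tm_frame)
  note D = D1 D2 D3 D4 D5 D6 D7
  show "tm_Gamma L (Inl \<gamma>) (Inl \<alpha>) (Inl \<beta>) = berwald L \<gamma> \<alpha> \<beta>"
    "tm_Gamma L (Inr c) (Inl \<alpha>) (Inl \<beta>) = nonlin_cov L c \<alpha> \<beta>"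
    "tm_Gamma L (Inr c) (Inr a) (Inl \<beta>) = berwald L c a \<beta>"
    "tm_Gamma L (Inr c) (Inl \<alpha>) (Inr b) = berwald L c b \<alpha>"
    "tm_Gamma L (Inl \<gamma>) (Inr a) B = (\<lambda>_. 0)"
    "tm_Gamma L (Inl \<gamma>) A (Inr b) = (\<lambda>_. 0)"
    by (simp_all add: fun_eq_iff Inl Inr D nonlin_cov_def)
  show "tm_Gamma L C (Inr a) (Inr b) = (\<lambda>_. 0)"
    by (cases C) (simp_all add: fun_eq_iff Inl Inr D)
qed

section \<open>Curvature of the jet connection\<close>

lemma sum_UNIV_prod_type:
  fixes f :: "'i::finite \<times> 'j::finite \<Rightarrow> 'c::comm_monoid_add"
  shows "(\<Sum>I\<in>UNIV. f I) = (\<Sum>j\<in>UNIV. \<Sum>i\<in>UNIV. f (i, j))"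
  by (subst sum.swap) (simp add: sum.cartesian_product)

lemma sum_if_const: "(\<Sum>i\<in>I. if P then f i else 0) = (if P then (\<Sum>i\<in>I. f i) else 0)"
  by simp

section \<open>Chain rule along the projections to TM and TN\<close>

lemma bounded_linear_TM_part: "bounded_linear TM_part"
  by (intro linear_conv_bounded_linear[THEN iffD1] linearI) (simp_all add: TM_part_def vec_eq_iff)

definition TN_deriv :: "('p::finite, 'n::finite) jet \<Rightarrow> ('p, 'n) jet \<Rightarrow> real^('n + 'n)" where
  "TN_deriv z h = (\<chi> I. case I of Inl l \<Rightarrow> h $ hx l
     | Inr l \<Rightarrow> (\<Sum>a\<in>UNIV. z $ vX l (Inr a) * h $ hT (Inr a) + h $ vX l (Inr a) * z $ hT (Inr a)))"

lemma has_derivative_TN_part: "(TN_part has_derivative TN_deriv z) (at z)"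
proof -
  have "((\<lambda>z. TN_part z $ I) has_derivative (\<lambda>h. TN_deriv z h $ I)) (at z)" for I
    by (cases I) (auto simp: TN_part_def TN_deriv_def intro!: derivative_eq_intros bounded_linear_imp_has_derivative)
  then show ?thesis
    by (subst has_derivative_componentwise_within) (auto simp: Basis_vec_def inner_axis)
qed

text \<open>The constant \<open>r\<close> lets one rule serve both plain coefficients (r = 1) and
  those carrying a Kronecker factor.\<close>

lemma has_derivative_scaled_TM_part:
  assumes "smooth_on f S" "TM_part z \<in> S"
  shows "((\<lambda>z. r * f (TM_part z)) has_derivative (\<lambda>h. r * (\<Sum>I\<in>UNIV. TM_part h $ I * pd I f (TM_part z)))) (at z)"
proof -
  note d = smooth_on_imp_has_derivative[OF assms]
  from has_derivative_compose[OF bounded_linear_imp_has_derivative[OF bounded_linear_TM_part] d]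
  show ?thesis unfolding frechet_derivative_pd[OF d] by (rule has_derivative_mult_right)
qed

lemma has_derivative_scaled_TN_part:
  assumes "smooth_on f S" "TN_part z \<in> S"
  shows "((\<lambda>z. r * f (TN_part z)) has_derivative (\<lambda>h. r * (\<Sum>I\<in>UNIV. TN_deriv z h $ I * pd I f (TN_part z)))) (at z)"
proof -
  note d = smooth_on_imp_has_derivative[OF assms]
  from has_derivative_compose[OF has_derivative_TN_part d]
  show ?thesis unfolding frechet_derivative_pd[OF d] by (rule has_derivative_mult_right)
qed

lemma axis_nth_if: "axis I x $ J = (if J = I then x else 0)"
  by (simp add: axis_def)

lemma triangular_jet_frame: "triangular_frame (jet_frame L Lt) (range (\<lambda>(i, A). vX i A))"
proof
  fix K :: "('a, 'b) jidx" and u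
  show "K \<in> range (\<lambda>(i, A). vX i A) \<Longrightarrow> jet_frame L Lt K u = axis K 1" by auto
next
  fix I J :: "('a, 'b) jidx" and u
  assume "J \<notin> range (\<lambda>(i, A). vX i A)" "I \<notin> range (\<lambda>(i, A). vX i A)"
  moreover have "K \<in> range (\<lambda>(i, A). vX i A) \<or> (\<exists>A. K = hT A) \<or> (\<exists>i. K = hx i)" for K :: "('a, 'b) jidx"
    by (cases K; (cases "projr K")?) auto
  ultimately obtain "(\<exists>A. J = hT A) \<or> (\<exists>i. J = hx i)" "(\<exists>A. I = hT A) \<or> (\<exists>i. I = hx i)" by blast
  then show "jet_frame L Lt I u $ J = (if I = J then 1 else 0)"
    by (auto simp: axis_nth_if split: if_splits)
qed

lemma jet_frame_nth_vX:
  "jet_frame L Lt (hT A) z $ vX l C = - jet_M L l C A z"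
  "jet_frame L Lt (hx i) z $ vX l C = - jet_N Lt l C i z"
proof -
  have "(\<Sum>j\<in>UNIV. \<Sum>B\<in>UNIV. m j B * axis (vX j B) 1 $ vX l C) = m l C" for m :: "'b \<Rightarrow> 'a + 'a \<Rightarrow> real"
  proof -
    have "(\<Sum>j\<in>UNIV. \<Sum>B\<in>UNIV. m j B * axis (vX j B) 1 $ vX l C)
        = (\<Sum>j\<in>UNIV. if j = l then \<Sum>B\<in>UNIV. if C = B then m j B else 0 else 0)"
      by (intro sum.cong) (auto simp: axis_nth_if if_distrib[of "\<lambda>r. _ * r"] intro!: sum.neutral cong: if_cong)
    then show ?thesis by simp
  qed
  then show "jet_frame L Lt (hT A) z $ vX l C = - jet_M L l C A z"
    "jet_frame L Lt (hx i) z $ vX l C = - jet_N Lt l C i z"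
    by (simp_all add: axis_nth_if[of "hT A"] axis_nth_if[of "hx i"])
qed

lemma TM_part_jet_frame:
  "TM_part (jet_frame L Lt (hT A) z) = axis A 1"
  "TM_part (jet_frame L Lt (hx i) z) = 0"
  "TM_part (jet_frame L Lt (vX i B) z) = 0"
  by (simp_all add: TM_part_def vec_eq_iff axis_nth_if)

text \<open>Push-forward of the frame under (x, y s). Only the coordinates y^l_a enter, so the
  directions x^k_\<gamma> give zero; along s^b the M-correction to y drops out because Gamma
  vanishes on two Latin lower indices.\<close>

lemma TN_deriv_jet_frame:
  "TN_deriv z (jet_frame L Lt (hT (Inl \<beta>)) z) $ Inl l = 0"
  "TN_deriv z (jet_frame L Lt (hT (Inl \<beta>)) z) $ Inr l =
     (\<Sum>c\<in>UNIV. \<Sum>a\<in>UNIV. berwald L c a \<beta> (TM_part z) * z $ hT (Inr a) * z $ vX l (Inr c))"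
  "TN_deriv z (jet_frame L Lt (hT (Inr b)) z) $ Inl l = 0"
  "TN_deriv z (jet_frame L Lt (hT (Inr b)) z) $ Inr l = z $ vX l (Inr b)"
  "TN_deriv z (jet_frame L Lt (hx k) z) $ Inl l = (if l = k then 1 else 0)"
  "TN_deriv z (jet_frame L Lt (hx k) z) $ Inr l =
     - (\<Sum>p\<in>UNIV. \<Sum>a\<in>UNIV. berwald Lt l k p (TN_part z) * z $ vX p (Inr a) * z $ hT (Inr a))"
  "TN_deriv z (jet_frame L Lt (vX k G) z) $ Inl l = 0"
  "TN_deriv z (jet_frame L Lt (vX k (Inl \<gamma>)) z) $ Inr l = 0"
  "TN_deriv z (jet_frame L Lt (vX k (Inr c)) z) $ Inr l = (if l = k then z $ hT (Inr c) else 0)"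
proof -
  have *: "TN_deriv z (jet_frame L Lt K z) $ Inr l = (\<Sum>a\<in>UNIV. z $ vX l (Inr a) * jet_frame L Lt K z $ hT (Inr a))
      + (\<Sum>a\<in>UNIV. jet_frame L Lt K z $ vX l (Inr a) * z $ hT (Inr a))" for K
    by (simp add: TN_deriv_def sum.distrib)
  have hT: "jet_frame L Lt (hT A) z $ hT B = (if B = A then 1 else 0)" "jet_frame L Lt (hx i) z $ hT B = 0" for A B i
    by (simp_all add: axis_nth_if)
  show "TN_deriv z (jet_frame L Lt (hT (Inl \<beta>)) z) $ Inr l =
     (\<Sum>c\<in>UNIV. \<Sum>a\<in>UNIV. berwald L c a \<beta> (TM_part z) * z $ hT (Inr a) * z $ vX l (Inr c))"
    unfolding * hT jet_frame_nth_vX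
    by (subst sum.swap) (simp add: jet_M_def sum_UNIV_sum_type tm_Gamma_simps sum_distrib_left mult_ac)
  show "TN_deriv z (jet_frame L Lt (hx k) z) $ Inr l =
     - (\<Sum>p\<in>UNIV. \<Sum>a\<in>UNIV. berwald Lt l k p (TN_part z) * z $ vX p (Inr a) * z $ hT (Inr a))"
    unfolding * hT jet_frame_nth_vX
    by (subst sum.swap) (simp add: jet_N_def sum_negf sum_distrib_left mult_ac)
  show "TN_deriv z (jet_frame L Lt (hT (Inr b)) z) $ Inr l = z $ vX l (Inr b)"
    unfolding * hT jet_frame_nth_vX
    by (simp add: jet_M_def sum_UNIV_sum_type tm_Gamma_simps if_distrib[of "\<lambda>r. _ * r"] cong: if_cong)
  show "TN_deriv z (jet_frame L Lt (vX k (Inr c)) z) $ Inr l = (if l = k then z $ hT (Inr c) else 0)"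
    by (simp add: TN_deriv_def axis_nth_if
        if_distrib[of "\<lambda>r. _ * r"] if_distrib[of "\<lambda>r. r * _"] cong: if_cong)
qed (simp_all add: TN_deriv_def axis_nth_if)

locale jet_sprays =
  M: smooth_spray L S + N: smooth_spray Lt T
  for L :: "real^('p::finite + 'p) \<Rightarrow> real" and S
    and Lt :: "real^('n::finite + 'n) \<Rightarrow> real" and T +
  fixes z :: "('p, 'n) jet"
  assumes TM_in: "TM_part z \<in> S" and TN_in: "TN_part z \<in> T"
begin

sublocale triangular_frame "jet_frame L Lt" "range (\<lambda>(i, A). vX i A)"
  by (rule triangular_jet_frame)

lemma smooth_on_tm_Gamma: "smooth_on (tm_Gamma L C A B) S"
  by (cases A; cases B; cases C)
    (simp_all add: tm_Gamma_simps smooth_on_const M.smooth_on_berwald M.smooth_on_nonlin_cov)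

text \<open>All corrections in the jet frame are vertical and disappear under projection to TM;
  \<open>Inr K\<close> covers the x and the X fields at once.\<close>

lemma frame_derivative_TM:
  assumes "smooth_on f S"
  shows "frechet_derivative (\<lambda>z. r * f (TM_part z)) (at z) (jet_frame L Lt (hT A) z) = r * pd A f (TM_part z)"
    "frechet_derivative (\<lambda>z. r * f (TM_part z)) (at z) (jet_frame L Lt (Inr K) z) = 0"
proof -
  note d = frechet_derivative_at[OF has_derivative_scaled_TM_part[OF assms TM_in], symmetric]
  show "frechet_derivative (\<lambda>z. r * f (TM_part z)) (at z) (jet_frame L Lt (hT A) z) = r * pd A f (TM_part z)"
    unfolding d TM_part_jet_frame by (simp add: axis_nth_if if_distrib[of "\<lambda>r. r * _"] cong: if_cong)
  have "TM_part (jet_frame L Lt (Inr K) z) = 0"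
    using TM_part_jet_frame(2,3)[where z = z and L = L and Lt = Lt] by (cases K; (cases "projr K")?) auto
  then show "frechet_derivative (\<lambda>z. r * f (TM_part z)) (at z) (jet_frame L Lt (Inr K) z) = 0"
    unfolding d by simp
qed

lemma frame_derivative_TN:
  assumes "smooth_on f T"
  shows "frechet_derivative (\<lambda>z. r * f (TN_part z)) (at z) (jet_frame L Lt K z) =
    r * (\<Sum>I\<in>UNIV. TN_deriv z (jet_frame L Lt K z) $ I * pd I f (TN_part z))"
  unfolding frechet_derivative_at[OF has_derivative_scaled_TN_part[OF assms TN_in], symmetric] ..

text \<open>Supplies the differentiability that \<open>lie_bracket_horizontal\<close> requires of
  both fields.\<close>

lemma differentiable_jet_frame: "jet_frame L Lt K differentiable (at z)"
proof -
  have f: "(\<lambda>z. f (TM_part z)) differentiable (at z)" if "smooth_on f S" for f :: "real^('p + 'p) \<Rightarrow> real"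
    using has_derivative_scaled_TM_part[OF that TM_in, of 1] by (auto simp: differentiable_def)
  have g: "(\<lambda>z. f (TN_part z)) differentiable (at z)" if "smooth_on f T" for f :: "real^('n + 'n) \<Rightarrow> real"
    using has_derivative_scaled_TN_part[OF that TN_in, of 1] by (auto simp: differentiable_def)
  have n: "(\<lambda>z :: ('p, 'n) jet. z $ I) differentiable (at z)" for I
    by (rule bounded_linear_imp_differentiable[OF bounded_linear_vec_nth])
  have sR: "(\<lambda>z. h z *\<^sub>R c) differentiable (at z)" if "h differentiable (at z)"
    for h :: "('p, 'n) jet \<Rightarrow> real" and c :: "('p, 'n) jet"
    using that bounded_linear.has_derivative[OF bounded_linear_scaleR_left]
    unfolding differentiable_def by blast
  have M: "jet_M L j B A differentiable (at z)" for j :: 'n and A B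
    unfolding jet_M_def[abs_def]
    by (intro differentiable_minus differentiable_sum ballI differentiable_mult f n smooth_on_tm_Gamma) simp
  have N: "jet_N Lt j B i differentiable (at z)" for j i and B :: "'p + 'p"
    unfolding jet_N_def[abs_def]
    by (intro differentiable_sum ballI differentiable_mult g n N.smooth_on_berwald) simp
  consider A where "K = hT A" | i where "K = hx i" | i A where "K = vX i A"
    by (metis sumE surj_pair)
  then show ?thesis
  proof cases
    case (1 A)
    have "(\<lambda>z. jet_frame L Lt (hT A) z) differentiable (at z)"
      by (simp, intro differentiable_diff differentiable_const differentiable_sum ballI sR M) simp_all
    then show ?thesis unfolding 1 .
  next
    case (2 i)
    have "(\<lambda>z. jet_frame L Lt (hx i) z) differentiable (at z)"
      by (simp, intro differentiable_diff differentiable_const differentiable_sum ballI sR N) simp_all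
    then show ?thesis unfolding 2 .
  next
    case (3 i A)
    have "(\<lambda>z. jet_frame L Lt (vX i A) z) differentiable (at z)" by simp
    then show ?thesis unfolding 3 .
  qed
qed

lemma jet_coeff_vertical: "jet_coeff L Lt H I (vX i A) = (\<lambda>_. 0)"
  by (intro ext, cases "(L, Lt, H, I, vX i A, z)" rule: jet_coeff.cases) auto

lemma d_curv_eq:
  "d_curv L Lt H I J K z =
    frechet_derivative (jet_coeff L Lt H I J) (at z) (jet_frame L Lt K z)
    - frechet_derivative (jet_coeff L Lt H I K) (at z) (jet_frame L Lt J z)
    + (\<Sum>M\<in>UNIV. jet_coeff L Lt H M K z * jet_coeff L Lt M I J z)
    - (\<Sum>M\<in>UNIV. jet_coeff L Lt H M J z * jet_coeff L Lt M I K z)"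
proof -
  have *: "jet_coeff L Lt H I M z
      * frame_comp (jet_frame L Lt) z (lie_bracket (jet_frame L Lt K) (jet_frame L Lt J) z) M = 0" for M
    using lie_bracket_horizontal[OF differentiable_jet_frame differentiable_jet_frame]
    by (cases "M \<in> range (\<lambda>(i, A). vX i A)") (auto simp: jet_coeff_vertical)
  then show ?thesis
    unfolding d_curv_def jet_berwald_def frame_comp_curvature * by simp
qed

text \<open>Equations between functions, since the coefficients get differentiated; the factor
  \<open>1\<close> matches the scaled chain rules.\<close>

lemma jet_coeff_eq:
  "jet_coeff L Lt (hT A) (hT B) (hT C) = (\<lambda>z. 1 * tm_Gamma L A B C (TM_part z))"
  "jet_coeff L Lt (vX i A) (vX j B) (hT C) = (\<lambda>z. - kron i j * tm_Gamma L B C A (TM_part z))"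
  "jet_coeff L Lt (hx k) (hx i) (hx j) = (\<lambda>z. 1 * berwald Lt k i j (TN_part z))"
  "jet_coeff L Lt (vX i A) (vX j B) (hx k) = (\<lambda>z. kron B A * berwald Lt i j k (TN_part z))"
  "jet_coeff L Lt (hT A) (Inr I') J = (\<lambda>_. 0)"
  "jet_coeff L Lt (Inr H') (hT B) J = (\<lambda>_. 0)"
  "jet_coeff L Lt (hT A) I (Inr J') = (\<lambda>_. 0)"
  "jet_coeff L Lt (hx k) (vX i A) J = (\<lambda>_. 0)"
  "jet_coeff L Lt (vX i A) (hx k) J = (\<lambda>_. 0)"
  "jet_coeff L Lt (hx k) I (hT A) = (\<lambda>_. 0)"
proof -
  show "jet_coeff L Lt (hT A) (Inr I') J = (\<lambda>_. 0)" "jet_coeff L Lt (Inr H') (hT B) J = (\<lambda>_. 0)"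
    "jet_coeff L Lt (hT A) I (Inr J') = (\<lambda>_. 0)"
    "jet_coeff L Lt (hx k) (vX i A) J = (\<lambda>_. 0)" "jet_coeff L Lt (vX i A) (hx k) J = (\<lambda>_. 0)"
    "jet_coeff L Lt (hx k) I (hT A) = (\<lambda>_. 0)"
    by (intro ext, cases H' rule: sum.exhaust; cases I' rule: sum.exhaust; cases I rule: sum.exhaust;
        cases J rule: sum.exhaust; cases J' rule: sum.exhaust; force)+
qed (simp_all add: fun_eq_iff jet_Gbar_def jet_G_def jet_L_def jet_LX_def)

text \<open>The chain-rule value at \<open>z\<close> of the derivative of f o \<open>TN_part\<close>
  along the frame field \<open>K\<close>.\<close>

definition dN :: "('p, 'n) jidx \<Rightarrow> (real^('n + 'n) \<Rightarrow> real) \<Rightarrow> real" where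
  "dN K f = (\<Sum>I\<in>UNIV. TN_deriv z (jet_frame L Lt K z) $ I * pd I f (TN_part z))"

text \<open>An opaque name, so that simplification does not rewrite \<open>jet_coeff\<close> under
  the derivative.\<close>

definition coeff_deriv :: "('p, 'n) jidx \<Rightarrow> ('p, 'n) jidx \<Rightarrow> ('p, 'n) jidx \<Rightarrow> ('p, 'n) jidx \<Rightarrow> real" where
  "coeff_deriv H I J K = frechet_derivative (jet_coeff L Lt H I J) (at z) (jet_frame L Lt K z)"

lemma coeff_deriv_simps:
  "coeff_deriv (hT A) (hT B) (hT C) (hT D) = pd D (tm_Gamma L A B C) (TM_part z)"
  "coeff_deriv (hT A) (hT B) (hT C) (Inr K) = 0"
  "coeff_deriv (vX i A) (vX j B) (hT C) (hT D) = - kron i j * pd D (tm_Gamma L B C A) (TM_part z)"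
  "coeff_deriv (vX i A) (vX j B) (hT C) (Inr K) = 0"
  "coeff_deriv (hx k) (hx i) (hx j) M = dN M (berwald Lt k i j)"
  "coeff_deriv (vX i A) (vX j B) (hx k) M = kron B A * dN M (berwald Lt i j k)"
  "coeff_deriv (hT A) (Inr I') J M = 0"
  "coeff_deriv (Inr H') (hT B) J M = 0"
  "coeff_deriv (hT A) I (Inr J') M = 0"
  "coeff_deriv (hx k) (vX i A) J M = 0"
  "coeff_deriv (vX i A) (hx k) J M = 0"
  "coeff_deriv (hx k) I (hT A) M = 0"
  "coeff_deriv H I (vX i A) M = 0"
  by (simp_all only: coeff_deriv_def jet_coeff_eq jet_coeff_vertical frechet_derivative_const dN_def
      frame_derivative_TM[OF smooth_on_tm_Gamma] frame_derivative_TN[OF N.smooth_on_berwald])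

lemma coeff_simps:
  "jet_coeff L Lt (hT A) (Inr I') J z = 0"
  "jet_coeff L Lt (Inr H') (hT B) J z = 0"
  "jet_coeff L Lt (hT A) I (Inr J') z = 0"
  "jet_coeff L Lt (hx k) (vX i A) J z = 0"
  "jet_coeff L Lt (vX i A) (hx k) J z = 0"
  "jet_coeff L Lt (hx k) I (hT A) z = 0"
  "jet_coeff L Lt H I (vX i A) z = 0"
  by (simp_all add: jet_coeff_eq jet_coeff_vertical)

text \<open>The summation index runs through the blocks T, x and X. The connection preserves each
  block, so \<open>coeff_simps\<close> leaves products only from the block of
  \<open>H\<close>.\<close>

lemma d_curv_expand:
  "d_curv L Lt H I J K z = coeff_deriv H I J K - coeff_deriv H I K J
    + (\<Sum>A\<in>UNIV. jet_coeff L Lt H (hT A) K z * jet_coeff L Lt (hT A) I J z)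
    + (\<Sum>i\<in>UNIV. jet_coeff L Lt H (hx i) K z * jet_coeff L Lt (hx i) I J z)
    + (\<Sum>A\<in>UNIV. \<Sum>i\<in>UNIV. jet_coeff L Lt H (vX i A) K z * jet_coeff L Lt (vX i A) I J z)
    - (\<Sum>A\<in>UNIV. jet_coeff L Lt H (hT A) J z * jet_coeff L Lt (hT A) I K z)
    - (\<Sum>i\<in>UNIV. jet_coeff L Lt H (hx i) J z * jet_coeff L Lt (hx i) I K z)
    - (\<Sum>A\<in>UNIV. \<Sum>i\<in>UNIV. jet_coeff L Lt H (vX i A) J z * jet_coeff L Lt (vX i A) I K z)"
  unfolding d_curv_eq coeff_deriv_def
  by (simp add: sum_UNIV_sum_type[where 'i="'p + 'p" and 'j="'n + 'n \<times> ('p + 'p)"]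
      sum_UNIV_sum_type[where 'i="'n" and 'j="'n \<times> ('p + 'p)"] sum_UNIV_prod_type
      del: jet_coeff.simps)

section \<open>The d-curvatures, one type of index pattern at a time\<close>

lemmas d_curv_simps = d_curv_expand coeff_deriv_simps coeff_simps jet_Gbar_def jet_G_def jet_L_def jet_LX_def

text \<open>This is the curvature of the Berwald connection of TM in the coordinate basis, pulled
  back to the jet space.\<close>

lemma d_curv_TTT:
  "d_curv L Lt (hT D) (hT A) (hT B) (hT C) z =
    pd C (tm_Gamma L D A B) (TM_part z) - pd B (tm_Gamma L D A C) (TM_part z)
    + (\<Sum>M\<in>UNIV. tm_Gamma L D M C (TM_part z) * tm_Gamma L M A B (TM_part z))
    - (\<Sum>M\<in>UNIV. tm_Gamma L D M B (TM_part z) * tm_Gamma L M A C (TM_part z))"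
  by (simp add: d_curv_simps)

text \<open>The matrix of \<open>jet_G\<close> is minus a transposed Gamma, so the products appear
  in reversed order; summing the Kronecker factors over the middle index leaves
  \<open>kron l i\<close>.\<close>

lemma d_curv_XTT:
  "d_curv L Lt (vX l D) (vX i A) (hT B) (hT C) z = - kron l i *
    (pd C (tm_Gamma L A B D) (TM_part z) - pd B (tm_Gamma L A C D) (TM_part z)
    - (\<Sum>M\<in>UNIV. tm_Gamma L A B M (TM_part z) * tm_Gamma L M C D (TM_part z))
    + (\<Sum>M\<in>UNIV. tm_Gamma L A C M (TM_part z) * tm_Gamma L M B D (TM_part z)))"
  by (cases "l = i") (simp_all add: d_curv_simps kron_def sum_if_const if_distrib[of uminus]
      if_distrib[of "\<lambda>r. _ * r"] if_distrib[of "\<lambda>r. r * _"]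
      mult_ac cong: if_cong)

lemma d_curv_xTx: "d_curv L Lt (hx l) (hx i) (hT B) (hx k) z = - dN (hT B) (berwald Lt l i k)"
  by (simp add: d_curv_simps)

lemma d_curv_xxx: "d_curv L Lt (hx l) (hx i) (hx j) (hx k) z =
    dN (hx k) (berwald Lt l i j) - dN (hx j) (berwald Lt l i k)
    + (\<Sum>m\<in>UNIV. berwald Lt m i j (TN_part z) * berwald Lt l m k (TN_part z))
    - (\<Sum>m\<in>UNIV. berwald Lt m i k (TN_part z) * berwald Lt l m j (TN_part z))"
  by (simp add: d_curv_simps mult_ac)

lemma d_curv_xxX: "d_curv L Lt (hx l) (hx i) (hx j) (vX k G) z = dN (vX k G) (berwald Lt l i j)"
  by (simp add: d_curv_simps)

text \<open>Both mixed products of \<open>jet_G\<close> and \<open>jet_LX\<close> equal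
  -Gamma^A_{BD} B^l_{ik}, since each is a Kronecker symbol in the index that the other acts on. They
  cancel, and only the derivative of \<open>jet_LX\<close> survives.\<close>

lemma d_curv_XTx:
  "d_curv L Lt (vX l D) (vX i A) (hT B) (hx k) z = kron A D * d_curv L Lt (hx l) (hx i) (hT B) (hx k) z"
  by (simp add: d_curv_simps kron_def sum_if_const if_distrib[of uminus]
      if_distrib[of "\<lambda>r. _ * r"] if_distrib[of "\<lambda>r. r * _"]
      mult_ac cong: if_cong)

lemma d_curv_Xxx:
  "d_curv L Lt (vX l D) (vX i A) (hx j) (hx k) z = kron A D * d_curv L Lt (hx l) (hx i) (hx j) (hx k) z"
  by (cases "A = D") (simp_all add: d_curv_simps kron_def sum_if_const if_distrib[of uminus]
      if_distrib[of "\<lambda>r. _ * r"] if_distrib[of "\<lambda>r. r * _"]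
      mult_ac cong: if_cong)

lemma d_curv_XxX:
  "d_curv L Lt (vX l D) (vX i A) (hx j) (vX k G) z = kron A D * d_curv L Lt (hx l) (hx i) (hx j) (vX k G) z"
  by (simp add: d_curv_simps)

text \<open>Every vanishing statement thus needs proof for one order of the directions only.\<close>

lemma d_curv_swap: "d_curv L Lt H I K J z = - d_curv L Lt H I J K z"
  by (simp add: d_curv_expand)

text \<open>The causes are the invariance of the three blocks, the vanishing of coefficients in
  vertical directions and of \<open>jet_L\<close> in T directions, and the fact that
  \<open>jet_Gbar\<close> and \<open>jet_G\<close> depend on the TM coordinates alone.\<close>

lemma d_curv_zero:
  "d_curv L Lt (hT D) (Inr I') J K z = 0" "d_curv L Lt (Inr H') (hT A) J K z = 0"
  "d_curv L Lt (hx l) (vX i A) J K z = 0" "d_curv L Lt (vX i A) (hx l) J K z = 0"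
  "d_curv L Lt H I (vX j B) (vX k C) z = 0"
  "d_curv L Lt (hT A) (hT B) (hT C) (Inr K') z = 0"
  "d_curv L Lt (hT A) (hT B) (Inr J') (Inr K') z = 0"
  "d_curv L Lt (hx l) (hx i) (hT A) (hT B) z = 0"
  "d_curv L Lt (hx l) (hx i) (hT A) (vX k G) z = 0"
  "d_curv L Lt (vX l D) (vX i A) (hT B) (vX k G) z = 0"
  by (simp_all add: d_curv_simps)

end

section \<open>Capital indices split into Greek and Latin ones\<close>

lemma kron_sum_simps [simp]:
  "kron (Inl i) (Inl j) = kron i j" "kron (Inr i) (Inr j) = kron i j"
  "kron (Inl i) (Inr j) = 0" "kron (Inr i) (Inl j) = 0"
  by (simp_all add: kron_def)

lemma jidx_cases:
  fixes I :: "('q, 'm) jidx"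
  obtains \<alpha> where "I = hT (Inl \<alpha>)" | a where "I = hT (Inr a)" | i where "I = hx i"
    | i \<alpha> where "I = vX i (Inl \<alpha>)" | i a where "I = vX i (Inr a)"
  by (metis sumE surj_pair)

context jet_sprays
begin

text \<open>Permutative rules that bring lower indices into a normal order by ordered rewriting; the
  second and third together express the total symmetry of P.\<close>

lemmas commute =
  M.berwald_commute[OF TM_in] M.pd_berwald_commute[OF TM_in]
  M.berwald_P_commute(2)[OF TM_in, unfolded berwald_P_def]

lemma dN_simps:
  "dN (hT (Inl \<beta>)) f = (\<Sum>j\<in>UNIV. \<Sum>c\<in>UNIV. \<Sum>a\<in>UNIV.
     pd (Inr j) f (TN_part z) * berwald L c \<beta> a (TM_part z) * z $ hT (Inr a) * z $ vX j (Inr c))"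
  "dN (hT (Inr b)) f = (\<Sum>j\<in>UNIV. pd (Inr j) f (TN_part z) * z $ vX j (Inr b))"
  "dN (hx k) f = pd (Inl k) f (TN_part z) - (\<Sum>p\<in>UNIV. \<Sum>b\<in>UNIV.
     (\<Sum>r\<in>UNIV. pd (Inr r) f (TN_part z) * berwald Lt r k p (TN_part z)) * z $ vX p (Inr b) * z $ hT (Inr b))"
  "dN (vX k (Inl \<gamma>)) f = 0"
  "dN (vX k (Inr c)) f = pd (Inr k) f (TN_part z) * z $ hT (Inr c)"
proof -
  \<comment> \<open>Moves the sum over the fibre index \<open>r\<close> outermost, where the chain
    rule puts it.\<close>
  have swap: "(\<Sum>p\<in>UNIV. \<Sum>b\<in>UNIV. \<Sum>r\<in>UNIV. h p b r) = (\<Sum>r\<in>UNIV. \<Sum>p\<in>UNIV. \<Sum>b\<in>UNIV. h p b r)"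
    for h :: "'n \<Rightarrow> 'p \<Rightarrow> 'n \<Rightarrow> real"
    by (subst sum.swap[where A = "UNIV :: 'p set"], subst sum.swap) simp
  show "dN (hx k) f = pd (Inl k) f (TN_part z) - (\<Sum>p\<in>UNIV. \<Sum>b\<in>UNIV.
     (\<Sum>r\<in>UNIV. pd (Inr r) f (TN_part z) * berwald Lt r k p (TN_part z)) * z $ vX p (Inr b) * z $ hT (Inr b))"
    unfolding dN_def sum_UNIV_sum_type TN_deriv_jet_frame sum_distrib_right swap
    by (simp add: if_distrib[of "\<lambda>r. r * _"] if_distrib[of "\<lambda>r. _ * r"] sum_distrib_left sum_distrib_right sum_negf mult_ac cong: if_cong)
qed (simp_all add: dN_def sum_UNIV_sum_type TN_deriv_jet_frame sum_distrib_left sum_distrib_right mult_ac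
    if_distrib[of "\<lambda>r. _ * r"] M.berwald_commute[OF TM_in] del: jet_frame.simps cong: if_cong)

lemma pd_zero [simp]: "pd I (\<lambda>_. 0) u = 0"
  by (simp add: pd_def)

lemmas Gamma_simps = sum_UNIV_sum_type tm_Gamma_simps berwald_R_def delta_t_def berwald_P_def alt_def
  commute sum_negf mult_ac

text \<open>The first holds because the fields d/ds span a subbundle that the connection preserves.
  In the second, two fibre derivatives of B are subtracted and cancel by the total symmetry of
  P.\<close>

lemma d_curv_TTT_zero:
  "d_curv L Lt (hT (Inl \<delta>)) (hT (Inr a)) (hT B) (hT C) z = 0"
  "d_curv L Lt (hT D) (hT A) (hT (Inr b)) (hT (Inr c)) z = 0"
  subgoal by (cases B; cases C; simp add: d_curv_TTT Gamma_simps)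
  subgoal by (cases D; cases A; simp add: d_curv_TTT Gamma_simps)
  done

text \<open>The transposed counterparts: the invariant subbundle now forbids a Greek upper with a
  Latin lower index.\<close>

lemma d_curv_XTT_zero:
  "d_curv L Lt (vX l (Inr d)) (vX i (Inl \<alpha>)) (hT B) (hT C) z = 0"
  "d_curv L Lt (vX l D) (vX i A) (hT (Inr b)) (hT (Inr c)) z = 0"
  subgoal by (cases B; cases C; simp add: d_curv_XTT Gamma_simps)
  subgoal by (cases D; cases A; simp add: d_curv_XTT Gamma_simps)
  done

text \<open>Passing from d/dx^k to the operator \<open>delta_t\<close> of \<open>Lt\<close> adds P
  N, while the jet frame itself contributes -P B y s; antisymmetrizing in \<open>j\<close> and
  \<open>k\<close> gives all correction terms.\<close>

lemma d_curv_xxx_berwald: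
  "d_curv L Lt (hx l) (hx i) (hx j) (hx k) z =
    berwald_R Lt l i j k (TN_part z)
    + (\<Sum>r\<in>UNIV. berwald_P Lt l i j r (TN_part z) * nonlin Lt r k (TN_part z))
    - (\<Sum>r\<in>UNIV. berwald_P Lt l i k r (TN_part z) * nonlin Lt r j (TN_part z))
    + (\<Sum>p\<in>UNIV. \<Sum>b\<in>UNIV.
         ((\<Sum>r\<in>UNIV. berwald_P Lt l i k r (TN_part z) * berwald Lt r j p (TN_part z))
          - (\<Sum>r\<in>UNIV. berwald_P Lt l i j r (TN_part z) * berwald Lt r k p (TN_part z)))
         * z $ vX p (Inr b) * z $ hT (Inr b))"
  by (simp add: d_curv_xxx dN_simps berwald_R_def delta_t_def berwald_P_def left_diff_distrib
      sum_subtractf) (simp add: mult_ac)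

text \<open>\<open>listed\<close> records each pattern in one order of the directions, so both
  orders are excluded. Each of the 5^4 combinations of index kinds then meets a vanishing lemma or
  contradicts an assumption.\<close>

lemma d_curv_not_listed:
  assumes "\<not> listed H I J K" "\<not> listed H I K J"
  shows "d_curv L Lt H I J K z = 0"
proof -
  note zero = d_curv_zero d_curv_TTT_zero d_curv_XTT_zero
  \<comment> \<open>Each vanishing statement with its two directions exchanged, by
    antisymmetry.\<close>
  note zero' = zero[THEN d_curv_swap[THEN trans, OF arg_cong[where f = uminus]], simplified]
  have mixed: "d_curv L Lt (vX l (Inl \<epsilon>)) (vX i (Inr a)) (hT B) (hx k) z = 0"
    "d_curv L Lt (vX l (Inr d)) (vX i (Inl \<alpha>)) (hT B) (hx k) z = 0"
    "d_curv L Lt (vX l (Inl \<epsilon>)) (vX i (Inr a)) (hx j) (hx k) z = 0"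
    "d_curv L Lt (vX l (Inr d)) (vX i (Inl \<alpha>)) (hx j) (hx k) z = 0"
    "d_curv L Lt (vX l (Inl \<epsilon>)) (vX i (Inr a)) (hx j) (vX k G) z = 0"
    "d_curv L Lt (vX l (Inr d)) (vX i (Inl \<alpha>)) (hx j) (vX k G) z = 0"
    "d_curv L Lt (vX l D) (vX i A) (hx j) (vX k (Inl \<gamma>)) z = 0"
    "d_curv L Lt (hx l) (hx i) (hx j) (vX k (Inl \<gamma>)) z = 0"
    for l \<epsilon> i a B k d \<alpha> j G D A \<gamma>
    by (simp_all add: d_curv_XTx d_curv_Xxx d_curv_XxX d_curv_xxX dN_simps)
  note mixed' = mixed[THEN d_curv_swap[THEN trans, OF arg_cong[where f = uminus]], simplified]
  show ?thesis
    using assms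
    by (cases H rule: jidx_cases; cases I rule: jidx_cases;
        cases J rule: jidx_cases; cases K rule: jidx_cases;
        simp add: zero zero' mixed mixed' listed.intros)
qed

end

theorem theorem5p10:
  fixes M :: "'a topology" and \<A> :: "('a, 'p::finite) chart set" and F :: "('a, 'p) tm_fun"
    and N :: "'b topology" and \<B> :: "('b, 'n::finite) chart set" and Ft :: "('b, 'n) tm_fun"
    and cM :: "('a, 'p) chart" and cN :: "('b, 'n) chart" and z :: "('p, 'n) jet"
  defines "L \<equiv> chart_rep \<A> F cM" and "Lt \<equiv> chart_rep \<B> Ft cN"
  defines "Nl \<equiv> nonlin L" and "Nv \<equiv> nonlin_cov L" and "B \<equiv> berwald L"
    and "R \<equiv> berwald_R L" and "P \<equiv> berwald_P L"
  defines "Nt \<equiv> nonlin Lt" and "Bt \<equiv> berwald Lt" and "Rt \<equiv> berwald_R Lt" and "Pt \<equiv> berwald_P Lt"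
  defines "u \<equiv> TM_part z" and "w \<equiv> TN_part z"
    and "s \<equiv> \<lambda>a. z $ hT (Inr a)" and "y \<equiv> \<lambda>j a. z $ vX j (Inr a)"
  assumes M: "finsler_manifold M \<A> F" and N: "finsler_manifold N \<B> Ft"
    and charts: "cM \<in> \<A>" "cN \<in> \<B>"
    and z: "z \<in> jet_dom cM cN"
  shows
    "(\<forall>H I J K. \<not> listed H I J K \<and> \<not> listed H I K J \<longrightarrow> d_curv L Lt H I J K z = 0) \<and>
     (\<forall>\<delta> \<alpha> \<beta> \<gamma>. curv_TTT L Lt (Inl \<delta>) (Inl \<alpha>) (Inl \<beta>) (Inl \<gamma>) z =
        R \<delta> \<alpha> \<beta> \<gamma> u + (\<Sum>c\<in>UNIV. P \<delta> \<alpha> \<beta> c u * Nl c \<gamma> u) - (\<Sum>c\<in>UNIV. P \<delta> \<alpha> \<gamma> c u * Nl c \<beta> u)) \<and>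
     (\<forall>d \<alpha> \<beta> \<gamma>. curv_TTT L Lt (Inr d) (Inl \<alpha>) (Inl \<beta>) (Inl \<gamma>) z =
        alt (\<lambda>\<beta> \<gamma>. pd (Inl \<gamma>) (Nv d \<alpha> \<beta>) u + (\<Sum>c\<in>UNIV. Nv c \<alpha> \<beta> u * B d c \<gamma> u)
                     - (\<Sum>\<mu>\<in>UNIV. Nv d \<mu> \<beta> u * B \<mu> \<alpha> \<gamma> u)) \<beta> \<gamma>) \<and>
     (\<forall>\<delta> \<alpha> \<beta> c. curv_TTT L Lt (Inl \<delta>) (Inl \<alpha>) (Inl \<beta>) (Inr c) z = P \<delta> \<alpha> \<beta> c u) \<and>
     (\<forall>d \<alpha> \<beta> c. curv_TTT L Lt (Inr d) (Inl \<alpha>) (Inl \<beta>) (Inr c) z =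
        pd (Inr c) (Nv d \<alpha> \<beta>) u - pd (Inl \<beta>) (B d \<alpha> c) u
        + (\<Sum>\<mu>\<in>UNIV. B \<mu> \<alpha> \<beta> u * B d \<mu> c u) - (\<Sum>f\<in>UNIV. B f \<alpha> c u * B d f \<beta> u)) \<and>
     (\<forall>\<delta> \<alpha> b \<gamma>. curv_TTT L Lt (Inl \<delta>) (Inl \<alpha>) (Inr b) (Inl \<gamma>) z = - P \<delta> \<alpha> b \<gamma> u) \<and>
     (\<forall>d \<alpha> b \<gamma>. curv_TTT L Lt (Inr d) (Inl \<alpha>) (Inr b) (Inl \<gamma>) z =
        pd (Inl \<gamma>) (B d \<alpha> b) u - pd (Inr b) (Nv d \<alpha> \<gamma>) u
        + (\<Sum>c\<in>UNIV. B c \<alpha> b u * B d c \<gamma> u) - (\<Sum>\<mu>\<in>UNIV. B \<mu> \<alpha> \<gamma> u * B d \<mu> b u)) \<and>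
     (\<forall>d a \<beta> \<gamma>. curv_TTT L Lt (Inr d) (Inr a) (Inl \<beta>) (Inl \<gamma>) z =
        R d a \<beta> \<gamma> u + (\<Sum>c\<in>UNIV. P d a \<beta> c u * Nl c \<gamma> u) - (\<Sum>c\<in>UNIV. P d a \<gamma> c u * Nl c \<beta> u)) \<and>
     (\<forall>d a \<beta> c. curv_TTT L Lt (Inr d) (Inr a) (Inl \<beta>) (Inr c) z = P d a \<beta> c u) \<and>
     (\<forall>d a b \<gamma>. curv_TTT L Lt (Inr d) (Inr a) (Inr b) (Inl \<gamma>) z = - P d a b \<gamma> u) \<and>
     (\<forall>l i \<beta> k. curv_xTx L Lt l i (Inl \<beta>) k z =
        - (\<Sum>j\<in>UNIV. \<Sum>c\<in>UNIV. \<Sum>a\<in>UNIV. Pt l i k j w * B c \<beta> a u * s a * y j c)) \<and>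
     (\<forall>l i b k. curv_xTx L Lt l i (Inr b) k z = - (\<Sum>j\<in>UNIV. Pt l i k j w * y j b)) \<and>
     (\<forall>l i j k. curv_xxx L Lt l i j k z =
        Rt l i j k w + (\<Sum>r\<in>UNIV. Pt l i j r w * Nt r k w) - (\<Sum>r\<in>UNIV. Pt l i k r w * Nt r j w)
        + (\<Sum>p\<in>UNIV. \<Sum>b\<in>UNIV.
             ((\<Sum>r\<in>UNIV. Pt l i k r w * Bt r j p w) - (\<Sum>r\<in>UNIV. Pt l i j r w * Bt r k p w))
             * y p b * s b)) \<and>
     (\<forall>l i j k c. curvP_x L Lt l i j k (Inr c) z = Pt l i j k w * s c) \<and>
     (\<forall>l \<epsilon> i \<alpha> \<beta> \<gamma>. curv_XTT L Lt l (Inl \<epsilon>) i (Inl \<alpha>) (Inl \<beta>) (Inl \<gamma>) z =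
          - kron l i * (R \<alpha> \<epsilon> \<beta> \<gamma> u + (\<Sum>c\<in>UNIV. P \<alpha> \<epsilon> \<beta> c u * Nl c \<gamma> u)
                         - (\<Sum>c\<in>UNIV. P \<alpha> \<epsilon> \<gamma> c u * Nl c \<beta> u)) \<and>
        curv_XTT L Lt l (Inl \<epsilon>) i (Inl \<alpha>) (Inl \<beta>) (Inl \<gamma>) z =
          - kron l i * curv_TTT L Lt (Inl \<alpha>) (Inl \<epsilon>) (Inl \<beta>) (Inl \<gamma>) z) \<and>
     (\<forall>l \<epsilon> i \<alpha> \<beta> c. curv_XTT L Lt l (Inl \<epsilon>) i (Inl \<alpha>) (Inl \<beta>) (Inr c) z =
          - kron l i * P \<alpha> \<epsilon> \<beta> c u \<and>
        curv_XTT L Lt l (Inl \<epsilon>) i (Inl \<alpha>) (Inl \<beta>) (Inr c) z =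
          - kron l i * curv_TTT L Lt (Inl \<alpha>) (Inl \<epsilon>) (Inl \<beta>) (Inr c) z) \<and>
     (\<forall>l \<epsilon> i \<alpha> b \<gamma>. curv_XTT L Lt l (Inl \<epsilon>) i (Inl \<alpha>) (Inr b) (Inl \<gamma>) z =
          kron l i * P \<alpha> \<epsilon> b \<gamma> u \<and>
        curv_XTT L Lt l (Inl \<epsilon>) i (Inl \<alpha>) (Inr b) (Inl \<gamma>) z =
          - kron l i * curv_TTT L Lt (Inl \<alpha>) (Inl \<epsilon>) (Inr b) (Inl \<gamma>) z) \<and>
     (\<forall>l \<epsilon> i a \<beta> \<gamma>. curv_XTT L Lt l (Inl \<epsilon>) i (Inr a) (Inl \<beta>) (Inl \<gamma>) z =
        - kron l i *
          alt (\<lambda>\<beta> \<gamma>. pd (Inl \<gamma>) (Nv a \<beta> \<epsilon>) u + (\<Sum>c\<in>UNIV. Nv c \<beta> \<epsilon> u * B a c \<gamma> u)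
                       - (\<Sum>\<mu>\<in>UNIV. Nv a \<beta> \<mu> u * B \<mu> \<epsilon> \<gamma> u)) \<beta> \<gamma>) \<and>
     (\<forall>l \<epsilon> i a \<beta> c. curv_XTT L Lt l (Inl \<epsilon>) i (Inr a) (Inl \<beta>) (Inr c) z =
        - kron l i * (pd (Inr c) (Nv a \<beta> \<epsilon>) u - pd (Inl \<beta>) (B a c \<epsilon>) u
          + (\<Sum>\<mu>\<in>UNIV. B \<mu> \<beta> \<epsilon> u * B a \<mu> c u) - (\<Sum>d\<in>UNIV. B d c \<epsilon> u * B a d \<beta> u))) \<and>
     (\<forall>l \<epsilon> i a b \<gamma>. curv_XTT L Lt l (Inl \<epsilon>) i (Inr a) (Inr b) (Inl \<gamma>) z =
        - kron l i * (pd (Inl \<gamma>) (B a b \<epsilon>) u - pd (Inr b) (Nv a \<gamma> \<epsilon>) u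
          + (\<Sum>c\<in>UNIV. B c b \<epsilon> u * B a c \<gamma> u) - (\<Sum>\<mu>\<in>UNIV. B \<mu> \<gamma> \<epsilon> u * B a \<mu> b u))) \<and>
     (\<forall>l d i a \<beta> \<gamma>. curv_XTT L Lt l (Inr d) i (Inr a) (Inl \<beta>) (Inl \<gamma>) z =
          - kron l i * (R a d \<beta> \<gamma> u + (\<Sum>c\<in>UNIV. P a d \<beta> c u * Nl c \<gamma> u)
                         - (\<Sum>c\<in>UNIV. P a d \<gamma> c u * Nl c \<beta> u)) \<and>
        curv_XTT L Lt l (Inr d) i (Inr a) (Inl \<beta>) (Inl \<gamma>) z =
          - kron l i * curv_TTT L Lt (Inr a) (Inr d) (Inl \<beta>) (Inl \<gamma>) z) \<and>
     (\<forall>l d i a \<beta> c. curv_XTT L Lt l (Inr d) i (Inr a) (Inl \<beta>) (Inr c) z =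
          - kron l i * P a d \<beta> c u \<and>
        curv_XTT L Lt l (Inr d) i (Inr a) (Inl \<beta>) (Inr c) z =
          - kron l i * curv_TTT L Lt (Inr a) (Inr d) (Inl \<beta>) (Inr c) z) \<and>
     (\<forall>l d i a b \<gamma>. curv_XTT L Lt l (Inr d) i (Inr a) (Inr b) (Inl \<gamma>) z =
          kron l i * P a d b \<gamma> u \<and>
        curv_XTT L Lt l (Inr d) i (Inr a) (Inr b) (Inl \<gamma>) z =
          - kron l i * curv_TTT L Lt (Inr a) (Inr d) (Inr b) (Inl \<gamma>) z) \<and>
     (\<forall>l \<epsilon> i \<alpha> \<beta> k. curv_XTx L Lt l (Inl \<epsilon>) i (Inl \<alpha>) (Inl \<beta>) k z =
          - kron \<alpha> \<epsilon> * (\<Sum>j\<in>UNIV. \<Sum>c\<in>UNIV. \<Sum>b\<in>UNIV. Pt l i k j w * B c \<beta> b u * s b * y j c) \<and>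
        curv_XTx L Lt l (Inl \<epsilon>) i (Inl \<alpha>) (Inl \<beta>) k z =
          kron \<alpha> \<epsilon> * curv_xTx L Lt l i (Inl \<beta>) k z) \<and>
     (\<forall>l \<epsilon> i \<alpha> b k. curv_XTx L Lt l (Inl \<epsilon>) i (Inl \<alpha>) (Inr b) k z =
          - kron \<alpha> \<epsilon> * (\<Sum>j\<in>UNIV. Pt l i k j w * y j b) \<and>
        curv_XTx L Lt l (Inl \<epsilon>) i (Inl \<alpha>) (Inr b) k z =
          kron \<alpha> \<epsilon> * curv_xTx L Lt l i (Inr b) k z) \<and>
     (\<forall>l d i a \<beta> k. curv_XTx L Lt l (Inr d) i (Inr a) (Inl \<beta>) k z =
          - kron a d * (\<Sum>j\<in>UNIV. \<Sum>c\<in>UNIV. \<Sum>b\<in>UNIV. Pt l i k j w * B c \<beta> b u * s b * y j c) \<and>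
        curv_XTx L Lt l (Inr d) i (Inr a) (Inl \<beta>) k z =
          kron a d * curv_xTx L Lt l i (Inl \<beta>) k z) \<and>
     (\<forall>l d i a b k. curv_XTx L Lt l (Inr d) i (Inr a) (Inr b) k z =
          - kron a d * (\<Sum>j\<in>UNIV. Pt l i k j w * y j b) \<and>
        curv_XTx L Lt l (Inr d) i (Inr a) (Inr b) k z =
          kron a d * curv_xTx L Lt l i (Inr b) k z) \<and>
     (\<forall>l \<epsilon> i \<alpha> j k. curv_Xxx L Lt l (Inl \<epsilon>) i (Inl \<alpha>) j k z =
        kron \<alpha> \<epsilon> * curv_xxx L Lt l i j k z) \<and>
     (\<forall>l d i a j k. curv_Xxx L Lt l (Inr d) i (Inr a) j k z =
        kron a d * curv_xxx L Lt l i j k z) \<and>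
     (\<forall>l \<epsilon> i \<alpha> j k c. curvP_X L Lt l (Inl \<epsilon>) i (Inl \<alpha>) j k (Inr c) z =
          kron \<alpha> \<epsilon> * Pt l i j k w * s c \<and>
        curvP_X L Lt l (Inl \<epsilon>) i (Inl \<alpha>) j k (Inr c) z =
          kron \<alpha> \<epsilon> * curvP_x L Lt l i j k (Inr c) z) \<and>
     (\<forall>l d i a j k c. curvP_X L Lt l (Inr d) i (Inr a) j k (Inr c) z =
          kron a d * Pt l i j k w * s c \<and>
        curvP_X L Lt l (Inr d) i (Inr a) j k (Inr c) z =
          kron a d * curvP_x L Lt l i j k (Inr c) z)"
proof -
  interpret jet_sprays L "slit_dom cM" Lt "slit_dom cN" z
    using smooth_spray_chart_rep[OF M charts(1)] smooth_spray_chart_rep[OF N charts(2)] z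
    by (simp add: jet_sprays_def jet_sprays_axioms_def L_def Lt_def jet_dom_def)
  note local_defs = Nl_def Nv_def B_def R_def P_def Nt_def Bt_def Rt_def Pt_def u_def w_def s_def y_def
    curv_TTT_def curv_XTT_def curv_xTx_def curv_xxx_def curvP_x_def curv_XTx_def curv_Xxx_def curvP_X_def
  show ?thesis
    unfolding local_defs
    \<comment> \<open>The first goal is the vanishing claim. The thirty families are the component
      lemmas after splitting capital sums and normalizing lower indices with
      \<open>commute\<close>.\<close>
    by (intro conjI allI impI, blast intro: d_curv_not_listed)
      (simp_all add: d_curv_TTT d_curv_XTT d_curv_xTx d_curv_xxx_berwald d_curv_xxX
        d_curv_XTx d_curv_Xxx d_curv_XxX Gamma_simps dN_simps sum_distrib_left)
qed

end
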